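(* Let $d\ge1$ and let $X$ be a homogeneous Rademacher chaos of order $d$ with values in $B$, where $B$ is a Banach space for which there exists a countable set $D$ of linear functionals from the unit ball of the dual $B'$ such that $\|x\|=\sup_{f\in D}|f(x)|$ for each $x\in B$. Then for all $\alpha\in\mathbb{R}$, $$\mathbb{E}\,e^{\alpha\|X\|^{2/d}}<\infty.$$
   Context: Let $(\varepsilon_i)_{i\in\mathbb{N}}$ be independent Rademacher variables ($\mathbb{P}(\varepsilon_i=1)=\mathbb{P}(\varepsilon_i=-1)=1/2$). With $B$ and $D$ as in the statement, a $B$-valued random variable $X$ is a homogeneous Rademacher chaos of order $d$ if there is a family $(x_{i_1\ldots i_d})_{i_1,\ldots,i_d\in\mathbb{N}}$ in $B$, with $x_{i_1\ldots i_d}$ invariant under permutations of the indices and non-zero only if $i_1,\ldots,i_d$ are pairwise distinct, such that for every $f\in D$ the multiple series $\sum_{i_1,\ldots,i_d}f(x_{i_1\ldots i_d})\varepsilon_{i_1}\cdots\varepsilon_{i_d}$ converges almost surely, and the family $\big(\sum_{i_1,\ldots,i_d}f(x_{i_1\ldots i_d})\varepsilon_{i_1}\cdots\varepsilon_{i_d}\big)_{f\in D}$ has the same distribution as $(f(X))_{f\in D}$. *)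

theory Defs
  imports "HOL-Probability.Probability" "HOL-Combinatorics.Combinatorics"
begin

definition rademacher_sequence :: "'c measure \<Rightarrow> (nat \<Rightarrow> 'c \<Rightarrow> real) \<Rightarrow> bool" where
  "rademacher_sequence N \<epsilon> \<longleftrightarrow>
     prob_space N \<and>
     prob_space.indep_vars N (\<lambda>_. borel) \<epsilon> UNIV \<and>
     (\<forall>i. measure N {\<omega> \<in> space N. \<epsilon> i \<omega> = 1} = 1 / 2 \<and>
          measure N {\<omega> \<in> space N. \<epsilon> i \<omega> = -1} = 1 / 2)"

definition norming_set :: "('b::banach \<Rightarrow>\<^sub>L real) set \<Rightarrow> bool" where
  "norming_set D \<longleftrightarrow> D \<subseteq> cball 0 1 \<and> (\<forall>x. norm x = (SUP f\<in>D. \<bar>blinfun_apply f x\<bar>))"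

(* B need not be separable, so random variables with values in B are only required to be
   measurable through the countable norming set; this makes the norm measurable as well. *)
definition random_variable_via ::
  "('b::banach \<Rightarrow>\<^sub>L real) set \<Rightarrow> 'a measure \<Rightarrow> ('a \<Rightarrow> 'b) \<Rightarrow> bool" where
  "random_variable_via D M X \<longleftrightarrow> (\<forall>f\<in>D. (\<lambda>\<omega>. blinfun_apply f (X \<omega>)) \<in> borel_measurable M)"

(* A multi-index (i_1, ..., i_d) is a list of length d; values of x on lists of any other
   length play no role. *)
definition symmetric_tetrahedral :: "nat \<Rightarrow> (nat list \<Rightarrow> 'b::zero) \<Rightarrow> bool" where
  "symmetric_tetrahedral d x \<longleftrightarrow>
     (\<forall>is. length is = d \<longrightarrow>
        (\<forall>p. p permutes {..<d} \<longrightarrow> x (permute_list p is) = x is) \<and>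
        (x is \<noteq> 0 \<longrightarrow> distinct is))"

definition chaos_partial_sum ::
  "nat \<Rightarrow> (nat list \<Rightarrow> real) \<Rightarrow> (nat \<Rightarrow> 'c \<Rightarrow> real) \<Rightarrow> nat \<Rightarrow> 'c \<Rightarrow> real" where
  "chaos_partial_sum d a \<epsilon> n \<omega> =
     (\<Sum>is | length is = d \<and> set is \<subseteq> {..<n}. a is * (\<Prod>i\<leftarrow>is. \<epsilon> i \<omega>))"

(* The multiple series is the limit of its partial sums over the cubes {0, ..., n-1}^d. These
   converge, to the same value, whenever the rectangular partial sums (all d upper limits
   tending to infinity independently) do. Unconditional summability would be too strong, as
   it amounts to absolute convergence. *)
definition chaos_sum ::
  "nat \<Rightarrow> (nat list \<Rightarrow> real) \<Rightarrow> (nat \<Rightarrow> 'c \<Rightarrow> real) \<Rightarrow> 'c \<Rightarrow> real" where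
  "chaos_sum d a \<epsilon> \<omega> = lim (\<lambda>n. chaos_partial_sum d a \<epsilon> n \<omega>)"

(* X and the Rademacher sequence may live on different probability spaces: they are linked
   only by the equality of two laws on the product space of functions from D to the reals. *)
definition homogeneous_rademacher_chaos ::
  "nat \<Rightarrow> ('b::banach \<Rightarrow>\<^sub>L real) set \<Rightarrow> 'c measure \<Rightarrow> (nat \<Rightarrow> 'c \<Rightarrow> real) \<Rightarrow>
   'a measure \<Rightarrow> ('a \<Rightarrow> 'b) \<Rightarrow> bool" where
  "homogeneous_rademacher_chaos d D N \<epsilon> M X \<longleftrightarrow>
     random_variable_via D M X \<and>
     (\<exists>x. symmetric_tetrahedral d x \<and>
        (\<forall>f\<in>D. AE \<omega> in N. convergent (\<lambda>n. chaos_partial_sum d (\<lambda>is. blinfun_apply f (x is)) \<epsilon> n \<omega>)) \<and>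
        distr N (PiM D (\<lambda>_. borel)) (\<lambda>\<omega>. \<lambda>f\<in>D. chaos_sum d (\<lambda>is. blinfun_apply f (x is)) \<epsilon> \<omega>) =
        distr M (PiM D (\<lambda>_. borel)) (\<lambda>\<omega>. \<lambda>f\<in>D. blinfun_apply f (X \<omega>)))"

end

theory Submission
  imports Defs
begin

text \<open>Averages over finitely many signs are hypercontractive for nonnegative functions that are convex
  in each coordinate, in particular for norms of multi-affine polynomials. Hence the finite partial
  sums \<open>S\<^sub>m\<close> of the chaos satisfy \<open>\<parallel>S\<^sub>m\<parallel>\<^sub>p \<le> (c p / q) ^ (d / 2) \<parallel>S\<^sub>m\<parallel>\<^sub>q\<close> for \<open>q < p\<close>, and a
  Paley--Zygmund argument, applied to finite subsets of the norming set, bounds their second moments.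

  To reach every \<open>\<alpha>\<close> one needs \<open>\<parallel>S\<^sub>m\<parallel>\<^sub>p = o(p ^ (d / 2))\<close> uniformly in \<open>m\<close>. Fix \<open>q\<close> and split off the
  terms that involve one of the first \<open>n\<close> signs. They have lower degree in the remaining signs, so
  their \<open>L\<^sup>p\<close> norms grow like \<open>p ^ ((d - 1) / 2)\<close> only. The remaining tail is a backward
  conditional expectation of \<open>S\<^sub>m\<close>; for \<open>n\<close> large its \<open>L\<^sup>q\<close> norm is bounded independently of \<open>q\<close>,
  and hypercontractivity from \<open>q\<close> to \<open>p\<close> gains the factor \<open>q ^ (- d / 2)\<close>.\<close>

section \<open>Elementary inequalities\<close>

text \<open>Hypercontractivity from exponent 2 alone gives moments of order
  \<open>p ^ (d / 2)\<close>. The exponential is dominated by terms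
  \<open>(exp 1 * \<alpha> * norm X powr (2 / d) / n) ^ n\<close>, whose order in the norm is
  \<open>p = 2 * n / d\<close>, so such a bound yields a geometric series with ratio proportional to
  \<alpha> and settles only small \<alpha>. Starting from \<open>q = 2 * r\<close> instead divides
  the ratio by a power of \<open>r\<close>, provided that the other constants do not grow with
  \<open>r\<close>. This fixes the order of choices: \<open>V\<close> from the law, \<open>r\<close>
  from \<alpha> and \<open>V\<close>, and only then the number \<open>n\<close> of split-off signs,
  whose size is not controlled. That is harmless, because the terms brought in by \<open>n\<close>
  lose against \<open>p ^ (d / 2)\<close> as \<open>k\<close> grows with \<open>r\<close> fixed.
  Exponents are the naturals \<open>2 * r\<close> and \<open>2 * r * k\<close>, which keeps all
  powers integral and reduces hypercontractivity to binomial coefficients.\<close>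

lemma convex_combination_power_le:
  fixes x y t :: real
  assumes "0 \<le> x" "0 \<le> y" "0 \<le> t" "t \<le> 1"
  shows "(t * x + (1 - t) * y) ^ n \<le> t * x ^ n + (1 - t) * y ^ n"
proof (induction n)
  case (Suc n)
  let ?m = "t * x + (1 - t) * y"
  have mono: "0 \<le> (x - y) * (x ^ n - y ^ n)"
    using assms power_mono[of x y n] power_mono[of y x n]
    by (cases "x \<le> y") (auto intro: mult_nonneg_nonneg mult_nonpos_nonpos)
  have "?m ^ Suc n \<le> ?m * (t * x ^ n + (1 - t) * y ^ n)"
    using Suc assms by (auto intro!: mult_left_mono)
  also have "\<dots> = t * x ^ Suc n + (1 - t) * y ^ Suc n - t * (1 - t) * ((x - y) * (x ^ n - y ^ n))"
    by (simp add: algebra_simps)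
  also have "\<dots> \<le> t * x ^ Suc n + (1 - t) * y ^ Suc n"
    using mono assms by (simp del: power_Suc)
  finally show ?case .
qed simp

text \<open>Convexity of the power, applied to \<open>x / s\<close> and \<open>y / t\<close> with
  weights proportional to \<open>s\<close> and \<open>t\<close>. When \<open>s\<close> and
  \<open>t\<close> bound two L^n norms, averaging gives Minkowski's inequality without taking
  roots.\<close>

lemma add_power_le_weighted:
  fixes x y s t :: real
  assumes "0 \<le> x" "0 \<le> y" "0 < s" "0 < t"
  shows "(x + y) ^ n \<le> (s + t) ^ n * (s / (s + t) * (x / s) ^ n + t / (s + t) * (y / t) ^ n)"
proof -
  have eq: "1 - s / (s + t) = t / (s + t)"
    using assms by (simp add: field_simps)
  have "x + y = (s + t) * (s / (s + t) * (x / s) + t / (s + t) * (y / t))"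
    using assms by (simp add: distrib_left)
  then have "(x + y) ^ n = (s + t) ^ n * (s / (s + t) * (x / s) + t / (s + t) * (y / t)) ^ n"
    by (metis power_mult_distrib)
  also have "\<dots> \<le> (s + t) ^ n * (s / (s + t) * (x / s) ^ n + t / (s + t) * (y / t) ^ n)"
    using convex_combination_power_le[of "x / s" "y / t" "s / (s + t)" n] assms eq
    by (intro mult_left_mono) (auto simp: eq)
  finally show ?thesis .
qed

lemma add_power_le:
  fixes x y :: real
  assumes "0 \<le> x" "0 \<le> y"
  shows "(x + y) ^ n \<le> 2 ^ n * (x ^ n + y ^ n)"
proof -
  have "(x + y) ^ n \<le> 2 ^ n * (x ^ n / 2 + y ^ n / 2)"
    using add_power_le_weighted[of x y 1 1 n] assms by simp
  also have "\<dots> \<le> 2 ^ n * (x ^ n + y ^ n)"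
    using assms by (intro mult_left_mono add_mono) auto
  finally show ?thesis .
qed

lemma power_add_superadditive:
  fixes x y :: real
  assumes "0 \<le> x" "0 \<le> y" "1 \<le> n"
  shows "x ^ n + y ^ n \<le> (x + y) ^ n"
  using assms(3)
proof (induction n rule: dec_induct)
  case (step n)
  have "x ^ Suc n + y ^ Suc n \<le> (x + y) * (x ^ n + y ^ n)"
    using assms by (simp add: algebra_simps)
  also have "\<dots> \<le> (x + y) * (x + y) ^ n"
    using step assms by (intro mult_left_mono) auto
  finally show ?case by simp
qed simp

text \<open>Uniform convexity of powers. Averaged over \<open>b\<close> whose mean is at least
  \<open>a\<close>, it bounds an L^q distance by the increase of a \<open>q\<close>-th
  moment.\<close>

lemma power_tangent_gap:
  fixes a b :: real
  assumes "0 \<le> a" "0 \<le> b" "2 \<le> q"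
  shows "a ^ q + real q * a ^ (q - 1) * (b - a) + \<bar>b - a\<bar> ^ q \<le> b ^ q"
  using assms(3)
proof (induction q rule: dec_induct)
  case base
  show ?case by (simp add: power2_eq_square algebra_simps)
next
  case (step n)
  define h where "h = b - a"
  have b: "b = a + h" by (simp add: h_def)
  have n: "Suc n - 1 = n" "a ^ n = a * a ^ (n - 1)"
    using step by (auto simp flip: power_Suc)
  have "b * (a ^ n + real n * a ^ (n - 1) * h + \<bar>h\<bar> ^ n) \<le> b * b ^ n"
    using step assms by (intro mult_left_mono) (auto simp: h_def)
  moreover have "b * (a ^ n + real n * a ^ (n - 1) * h + \<bar>h\<bar> ^ n)
      = a ^ Suc n + real (Suc n) * a ^ n * h + (real n * a ^ (n - 1) * h\<^sup>2 + b * \<bar>h\<bar> ^ n)"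
    by (simp add: b n(2) algebra_simps power2_eq_square)
  \<comment> \<open>If \<open>h\<close> is nonnegative then |h| \<le> \<open>b\<close> and the last
    summand suffices; otherwise |h| \<le> \<open>a\<close> and the quadratic one does.\<close>
  moreover have "\<bar>h\<bar> ^ Suc n \<le> real n * a ^ (n - 1) * h\<^sup>2 + b * \<bar>h\<bar> ^ n"
  proof (cases "0 \<le> h")
    case True
    then have "\<bar>h\<bar> * \<bar>h\<bar> ^ n \<le> b * \<bar>h\<bar> ^ n"
      using assms by (intro mult_right_mono) (auto simp: b)
    then show ?thesis using assms by (simp add: add_increasing)
  next
    case False
    then have ha: "\<bar>h\<bar> \<le> a" using assms by (auto simp: h_def)
    have "\<bar>h\<bar> ^ Suc n = \<bar>h\<bar> ^ (n - 1) * h\<^sup>2"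
      using step by (auto simp: power2_eq_square power_eq_if abs_mult_self_eq algebra_simps)
    also have "\<dots> \<le> a ^ (n - 1) * h\<^sup>2"
      using ha by (intro mult_right_mono power_mono) auto
    also have "\<dots> \<le> real n * a ^ (n - 1) * h\<^sup>2"
      using step assms by (intro mult_right_mono) (auto simp: mult_le_cancel_right1)
    also have "\<dots> \<le> real n * a ^ (n - 1) * h\<^sup>2 + b * \<bar>h\<bar> ^ n"
      using assms by simp
    finally show ?thesis .
  qed
  ultimately show ?case by (simp add: n(1) flip: h_def)
qed

text \<open>The quotient of consecutive even coefficients of order \<open>2 * k\<close> is
  \<open>(k - j) / (j + 1)\<close>, the quotient for order \<open>k\<close>, times a factor
  \<open>(2 * k - 2 * j - 1) / (2 * j + 1)\<close>, which is at most \<open>2 * k\<close>.\<close>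

lemma binomial_double_le: "j \<le> k \<Longrightarrow> (2 * k) choose (2 * j) \<le> (2 * k) ^ j * (k choose j)"
proof (induction j)
  case (Suc j)
  have absorb: "Suc i * (n choose Suc i) = (n - i) * (n choose i)" for i n
    by (metis binomial_absorb_comp binomial_absorption)
  have odd: "(2 * j + 1) * ((2 * k) choose (2 * j + 1)) = (2 * k - 2 * j) * ((2 * k) choose (2 * j))"
    using absorb[of "2 * j" "2 * k"] by simp
  have even: "(2 * j + 2) * ((2 * k) choose (2 * Suc j)) = (2 * k - (2 * j + 1)) * ((2 * k) choose (2 * j + 1))"
    using absorb[of "2 * j + 1" "2 * k"] by simp
  have "(2 * j + 1) * (2 * j + 2) * ((2 * k) choose (2 * Suc j))
      = (2 * k - (2 * j + 1)) * ((2 * k - 2 * j) * ((2 * k) choose (2 * j)))"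
    unfolding mult.assoc even odd[symmetric] by (rule mult.left_commute)
  also have "\<dots> \<le> (2 * k) * ((2 * k - 2 * j) * ((2 * k) ^ j * (k choose j)))"
    using Suc by (intro mult_mono) auto
  also have "\<dots> = 2 * ((2 * k) ^ Suc j * ((k - j) * (k choose j)))"
    by (simp add: algebra_simps diff_mult_distrib2)
  also have "\<dots> = (2 * j + 2) * ((2 * k) ^ Suc j * (k choose Suc j))"
    unfolding absorb[symmetric] by (simp add: algebra_simps)
  also have "\<dots> \<le> (2 * j + 1) * (2 * j + 2) * ((2 * k) ^ Suc j * (k choose Suc j))"
    by simp
  finally show ?case
    by (simp only: mult_le_cancel1) simp
qed simp

lemma sum_even_atMost:
  fixes g :: "nat \<Rightarrow> real"
  shows "(\<Sum>i\<le>2 * k. if even i then g i else 0) = (\<Sum>j\<le>k. g (2 * j))"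
  by (induction k) simp_all

text \<open>Odd powers of \<open>c\<close> cancel and the even ones compare termwise. The factor
  \<open>2 * k\<close> is slightly worse than the optimal \<open>2 * k - 1\<close>.\<close>

lemma two_point_scalar:
  fixes a c :: real
  shows "((a + c) ^ (2 * k) + (a - c) ^ (2 * k)) / 2 \<le> (a\<^sup>2 + real (2 * k) * c\<^sup>2) ^ k"
proof -
  have "((a + c) ^ (2 * k) + (a - c) ^ (2 * k)) / 2 = ((c + a) ^ (2 * k) + (- c + a) ^ (2 * k)) / 2"
    by (simp add: add.commute)
  also have "\<dots> = (\<Sum>i\<le>2 * k. if even i then real ((2 * k) choose i) * c ^ i * a ^ (2 * k - i) else 0)"
    unfolding binomial_ring sum.distrib[symmetric] sum_divide_distrib by (intro sum.cong) auto
  also have "\<dots> = (\<Sum>j\<le>k. real ((2 * k) choose (2 * j)) * c ^ (2 * j) * a ^ (2 * k - 2 * j))"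
    by (rule sum_even_atMost)
  also have "\<dots> \<le> (\<Sum>j\<le>k. real ((2 * k) ^ j * (k choose j)) * c ^ (2 * j) * a ^ (2 * k - 2 * j))"
    using binomial_double_le[of _ k]
    by (intro sum_mono mult_right_mono) (auto simp: zero_le_even_power simp del: of_nat_mult of_nat_power)
  also have "\<dots> = (\<Sum>j\<le>k. real (k choose j) * (real (2 * k) * c\<^sup>2) ^ j * (a\<^sup>2) ^ (k - j))"
    by (intro sum.cong) (auto simp: power_mult_distrib power_mult[symmetric] diff_mult_distrib2)
  also have "\<dots> = (real (2 * k) * c\<^sup>2 + a\<^sup>2) ^ k"
    by (simp add: binomial_ring)
  finally show ?thesis by (simp add: add.commute)
qed

section \<open>Averages over signs\<close>

text \<open>Coordinates outside the list are read from \<open>e\<close>. Setting them to zero is,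
  for multi-affine polynomials, a conditional expectation, so martingale arguments need no measure
  theory here. The radius \<rho> serves the noise operator of hypercontractivity; everywhere else it
  is 1.\<close>

primrec sign_mean :: "real \<Rightarrow> nat list \<Rightarrow> ((nat \<Rightarrow> real) \<Rightarrow> real) \<Rightarrow> (nat \<Rightarrow> real) \<Rightarrow> real" where
  "sign_mean \<rho> [] g e = g e"
| "sign_mean \<rho> (i # I) g e = (sign_mean \<rho> I g (e(i := \<rho>)) + sign_mean \<rho> I g (e(i := - \<rho>))) / 2"

lemma sign_mean_append: "sign_mean \<rho> (I @ J) g e = sign_mean \<rho> I (sign_mean \<rho> J g) e"
  by (induction I arbitrary: e) auto

lemma sign_mean_add: "sign_mean \<rho> I (\<lambda>e. g e + h e) e = sign_mean \<rho> I g e + sign_mean \<rho> I h e"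
  by (induction I arbitrary: e) (auto simp: field_simps)

lemma sign_mean_cmult: "sign_mean \<rho> I (\<lambda>e. c * g e) e = c * sign_mean \<rho> I g e"
  by (induction I arbitrary: e) (auto simp: field_simps)

lemma sign_mean_const [simp]: "sign_mean \<rho> I (\<lambda>_. c) e = c"
  by (induction I arbitrary: e) auto

lemma sign_mean_mono_on:
  assumes "\<And>e'. (\<And>j. j \<notin> set I \<Longrightarrow> e' j = e j) \<Longrightarrow> g e' \<le> h e'"
  shows "sign_mean \<rho> I g e \<le> sign_mean \<rho> I h e"
  using assms
proof (induction I arbitrary: e)
  case (Cons i I)
  have "sign_mean \<rho> I g (e(i := u)) \<le> sign_mean \<rho> I h (e(i := u))" for u
    by (rule Cons.IH, rule Cons.prems) auto
  from this[of \<rho>] this[of "- \<rho>"] show ?case by simp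
qed auto

lemma sign_mean_mono: "(\<And>e. g e \<le> h e) \<Longrightarrow> sign_mean \<rho> I g e \<le> sign_mean \<rho> I h e"
  by (rule sign_mean_mono_on)

lemma sign_mean_nonneg: "(\<And>e. 0 \<le> g e) \<Longrightarrow> 0 \<le> sign_mean \<rho> I g e"
  using sign_mean_mono[of "\<lambda>_. 0" g \<rho> I e] by simp

lemma sign_mean_cong_on:
  assumes "\<And>e'. (\<And>j. j \<notin> set I \<Longrightarrow> e' j = e j) \<Longrightarrow> g e' = h e'"
  shows "sign_mean \<rho> I g e = sign_mean \<rho> I h e"
  by (intro antisym sign_mean_mono_on) (auto simp: assms)

lemma sign_mean_upd:
  "i \<notin> set I \<Longrightarrow> sign_mean \<rho> I g (e(i := u)) = sign_mean \<rho> I (\<lambda>e. g (e(i := u))) e"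
proof (induction I arbitrary: e)
  case (Cons j I)
  then have "i \<noteq> j" "i \<notin> set I" by auto
  then show ?case by (simp only: sign_mean.simps fun_upd_twist[of i j] Cons.IH not_False_eq_True)
qed simp

lemma sign_mean_commute:
  "set I \<inter> set J = {} \<Longrightarrow> sign_mean \<rho> I (sign_mean \<rho> J g) e = sign_mean \<rho> J (sign_mean \<rho> I g) e"
proof (induction I arbitrary: e)
  case Nil
  have "sign_mean \<rho> [] g = g" by auto
  then show ?case by simp
next
  case (Cons i I)
  have "sign_mean \<rho> J (sign_mean \<rho> (i # I) g) e
      = sign_mean \<rho> J (\<lambda>e. (1 / 2) * (sign_mean \<rho> I g (e(i := \<rho>)) + sign_mean \<rho> I g (e(i := - \<rho>)))) e"
    by (intro sign_mean_cong_on) simp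
  also have "\<dots> = (sign_mean \<rho> J (sign_mean \<rho> I g) (e(i := \<rho>)) + sign_mean \<rho> J (sign_mean \<rho> I g) (e(i := - \<rho>))) / 2"
    using Cons.prems by (simp only: sign_mean_add sign_mean_cmult) (simp add: sign_mean_upd)
  also have "\<dots> = sign_mean \<rho> (i # I) (sign_mean \<rho> J g) e"
    using Cons by (simp only: sign_mean.simps) simp
  finally show ?case by (rule sym)
qed

lemma sign_mean_scale:
  "sign_mean \<rho> I g (\<lambda>j. \<rho> * e j) = sign_mean 1 I (\<lambda>e. g (\<lambda>j. \<rho> * e j)) e"
proof (induction I arbitrary: e)
  case (Cons i I)
  have "(\<lambda>j. \<rho> * e j)(i := \<rho>) = (\<lambda>j. \<rho> * (e(i := 1)) j)"
    "(\<lambda>j. \<rho> * e j)(i := - \<rho>) = (\<lambda>j. \<rho> * (e(i := - 1)) j)"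
    by auto
  then show ?case by (simp only: sign_mean.simps Cons)
qed simp

section \<open>Jensen, Minkowski and submartingale inequalities for sign averages\<close>

lemma sign_mean_power_le:
  assumes "\<And>e. 0 \<le> g e"
  shows "sign_mean \<rho> I g e ^ n \<le> sign_mean \<rho> I (\<lambda>e. g e ^ n) e"
proof (induction I arbitrary: e)
  case (Cons i I)
  have "sign_mean \<rho> (i # I) g e ^ n
      \<le> (sign_mean \<rho> I g (e(i := \<rho>)) ^ n + sign_mean \<rho> I g (e(i := - \<rho>)) ^ n) / 2"
    using convex_combination_power_le[of "sign_mean \<rho> I g (e(i := \<rho>))" "sign_mean \<rho> I g (e(i := - \<rho>))" "1/2" n]
      sign_mean_nonneg[of g] assms by (simp add: field_simps)
  also have "\<dots> \<le> sign_mean \<rho> (i # I) (\<lambda>e. g e ^ n) e"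
    unfolding sign_mean.simps by (intro divide_right_mono add_mono Cons) auto
  finally show ?case .
qed simp

lemma sign_mean_minkowski:
  assumes "\<And>e. 0 \<le> g e" "\<And>e. 0 \<le> h e" "0 < s" "0 < t"
    and "sign_mean \<rho> I (\<lambda>e. g e ^ n) e \<le> s ^ n" "sign_mean \<rho> I (\<lambda>e. h e ^ n) e \<le> t ^ n"
  shows "sign_mean \<rho> I (\<lambda>e. (g e + h e) ^ n) e \<le> (s + t) ^ n"
proof -
  define c where "c = (s + t) ^ n"
  define w v where "w = s / (s + t) / s ^ n" and "v = t / (s + t) / t ^ n"
  have nonneg: "0 \<le> c" "0 \<le> w" "0 \<le> v" using assms by (auto simp: c_def w_def v_def)
  have "(g e + h e) ^ n \<le> c * (w * g e ^ n + v * h e ^ n)" for e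
    using add_power_le_weighted[OF assms(1,2,3,4), of e e n]
    by (simp add: c_def w_def v_def power_divide)
  then have "sign_mean \<rho> I (\<lambda>e. (g e + h e) ^ n) e
      \<le> sign_mean \<rho> I (\<lambda>e. c * (w * g e ^ n + v * h e ^ n)) e"
    by (rule sign_mean_mono)
  also have "\<dots> = c * (w * sign_mean \<rho> I (\<lambda>e. g e ^ n) e + v * sign_mean \<rho> I (\<lambda>e. h e ^ n) e)"
    by (simp add: sign_mean_add sign_mean_cmult)
  also have "\<dots> \<le> c * (w * s ^ n + v * t ^ n)"
    using assms nonneg by (intro mult_left_mono add_mono) auto
  also have "w * s ^ n + v * t ^ n = 1"
    using assms by (simp add: w_def v_def) (simp add: add_divide_distrib[symmetric])
  finally show ?thesis by (simp add: c_def)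
qed

text \<open>Only chords with endpoints 1 and -1 occur, a property that passes to powers and finite
  maxima. At \<open>u = 0\<close> it makes restoring a sign raise the mean; at
  \<open>u = \<rho>\<close> it feeds the two-point inequality.\<close>

definition coord_convex :: "((nat \<Rightarrow> real) \<Rightarrow> real) \<Rightarrow> bool" where
  "coord_convex \<phi> \<longleftrightarrow> (\<forall>e. 0 \<le> \<phi> e) \<and>
     (\<forall>e i u. \<bar>u\<bar> \<le> 1 \<longrightarrow>
        \<phi> (e(i := u)) \<le> (1 + u) / 2 * \<phi> (e(i := 1)) + (1 - u) / 2 * \<phi> (e(i := - 1)))"

lemma coord_convex_nonneg: "coord_convex \<phi> \<Longrightarrow> 0 \<le> \<phi> e"
  by (simp add: coord_convex_def)

lemma coord_convexD:
  "coord_convex \<phi> \<Longrightarrow> \<bar>u\<bar> \<le> 1 \<Longrightarrow>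
    \<phi> (e(i := u)) \<le> (1 + u) / 2 * \<phi> (e(i := 1)) + (1 - u) / 2 * \<phi> (e(i := - 1))"
  by (simp add: coord_convex_def)

lemma coord_convex_power: "coord_convex \<phi> \<Longrightarrow> coord_convex (\<lambda>e. \<phi> e ^ n)"
  unfolding coord_convex_def
proof safe
  fix e :: "nat \<Rightarrow> real" and i and u :: real
  assume nn: "\<forall>e. 0 \<le> \<phi> e" and u: "\<bar>u\<bar> \<le> 1"
    and *: "\<forall>e i u. \<bar>u\<bar> \<le> 1 \<longrightarrow> \<phi> (e(i := u)) \<le> (1 + u) / 2 * \<phi> (e(i := 1)) + (1 - u) / 2 * \<phi> (e(i := - 1))"
  have t: "1 - (1 + u) / 2 = (1 - u) / 2" by (simp add: field_simps)
  have "\<phi> (e(i := u)) ^ n \<le> ((1 + u) / 2 * \<phi> (e(i := 1)) + (1 - u) / 2 * \<phi> (e(i := - 1))) ^ n"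
    using nn * u by (intro power_mono) auto
  also have "\<dots> \<le> (1 + u) / 2 * \<phi> (e(i := 1)) ^ n + (1 - u) / 2 * \<phi> (e(i := - 1)) ^ n"
    using convex_combination_power_le[of "\<phi> (e(i := 1))" "\<phi> (e(i := - 1))" "(1 + u) / 2" n] nn u t
    by auto
  finally show "\<phi> (e(i := u)) ^ n \<le> (1 + u) / 2 * \<phi> (e(i := 1)) ^ n + (1 - u) / 2 * \<phi> (e(i := - 1)) ^ n" .
qed auto

lemma le_sign_mean_zeroed:
  assumes "coord_convex \<phi>" "e i = 0"
  shows "\<phi> e \<le> (\<phi> (e(i := 1)) + \<phi> (e(i := - 1))) / 2"
proof -
  have "e = e(i := 0)" using assms(2) by auto
  then show ?thesis using coord_convexD[OF assms(1), of 0 e i] by simp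
qed

text \<open>Jensen one coordinate at a time, zero being the mean of a sign: the submartingale
  property.\<close>

lemma le_sign_mean:
  assumes "coord_convex \<phi>" "distinct I" "\<And>i. i \<in> set I \<Longrightarrow> e i = 0"
  shows "\<phi> e \<le> sign_mean 1 I \<phi> e"
  using assms(2,3)
proof (induction I arbitrary: e)
  case (Cons i I)
  have "\<phi> (e(i := u)) \<le> sign_mean 1 I \<phi> (e(i := u))" for u
    by (rule Cons.IH) (use Cons.prems in auto)
  from this[of 1] this[of "- 1"] show ?case
    using le_sign_mean_zeroed[OF assms(1), of e i] Cons.prems by fastforce
qed simp

section \<open>Hypercontractivity\<close>

text \<open>For an even exponent pair \<open>(2 r, 2 r k)\<close> the two-point inequality reduces, by convexity of
  \<open>x ^ r\<close>, to the pair \<open>(2, 2 k)\<close>, where it is a comparison of binomial coefficients.\<close>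

lemma two_point_convex:
  assumes "coord_convex \<phi>" "\<rho> = 1 / sqrt (real (2 * k))" "1 \<le> k"
  shows "(\<phi> (e(i := \<rho>)) ^ (2 * r * k) + \<phi> (e(i := - \<rho>)) ^ (2 * r * k)) / 2
    \<le> ((\<phi> (e(i := 1)) ^ (2 * r) + \<phi> (e(i := - 1)) ^ (2 * r)) / 2) ^ k"
proof -
  have \<rho>: "0 \<le> \<rho>" "\<rho> \<le> 1" "real (2 * k) * \<rho>\<^sup>2 = 1"
    using assms(2,3) by (auto simp: power_divide)
  define s t where "s = \<phi> (e(i := 1)) ^ r" and "t = \<phi> (e(i := - 1)) ^ r"
  \<comment> \<open>At \<rho> and -\<rho> the function \<open>\<phi> ^ r\<close> is below the chord
    with midpoint value \<open>a\<close> and slope \<open>b\<close>, whose mean square over the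
    signs 1 and -1 is \<open>a\<^sup>2 + b\<^sup>2\<close>.\<close>
  define a b where "a = (s + t) / 2" and "b = (s - t) / 2"
  have \<psi>: "coord_convex (\<lambda>e. \<phi> e ^ r)" using assms(1) by (rule coord_convex_power)
  have "\<phi> (e(i := \<rho>)) ^ r \<le> a + \<rho> * b" "\<phi> (e(i := - \<rho>)) ^ r \<le> a - \<rho> * b"
    using coord_convexD[OF \<psi>, of \<rho> e i] coord_convexD[OF \<psi>, of "- \<rho>" e i] \<rho>
    by (auto simp: a_def b_def s_def t_def field_simps)
  then have "(\<phi> (e(i := \<rho>)) ^ r) ^ (2 * k) \<le> (a + \<rho> * b) ^ (2 * k)"
      "(\<phi> (e(i := - \<rho>)) ^ r) ^ (2 * k) \<le> (a - \<rho> * b) ^ (2 * k)"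
    using coord_convex_nonneg[OF \<psi>] by (auto intro!: power_mono)
  then have "(\<phi> (e(i := \<rho>)) ^ (2 * r * k) + \<phi> (e(i := - \<rho>)) ^ (2 * r * k)) / 2
      \<le> ((a + \<rho> * b) ^ (2 * k) + (a - \<rho> * b) ^ (2 * k)) / 2"
    unfolding power_mult[symmetric] by (intro divide_right_mono add_mono) (auto simp: ac_simps)
  also have "\<dots> \<le> (a\<^sup>2 + real (2 * k) * (\<rho> * b)\<^sup>2) ^ k"
    by (rule two_point_scalar)
  also have "a\<^sup>2 + real (2 * k) * (\<rho> * b)\<^sup>2 = a\<^sup>2 + b\<^sup>2"
    unfolding power_mult_distrib mult.assoc[symmetric] \<rho>(3) by simp
  also have "\<dots> = (s\<^sup>2 + t\<^sup>2) / 2"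
    by (simp add: a_def b_def power2_eq_square field_simps)
  finally show ?thesis
    by (simp only: s_def t_def power_mult[symmetric] mult.commute[of 2 r])
qed

text \<open>Minkowski in L^k of a single sign. The version for sign averages divides by
  \<open>s\<close> and \<open>t\<close>; vanishing bounds are handled separately, since they force
  both values to vanish.\<close>

lemma two_point_minkowski:
  fixes x1 x2 y1 y2 s t :: real
  assumes "0 \<le> x1" "0 \<le> x2" "0 \<le> y1" "0 \<le> y2" "0 \<le> s" "0 \<le> t" "1 \<le> k"
    and x: "(x1 ^ k + x2 ^ k) / 2 \<le> s ^ k" and y: "(y1 ^ k + y2 ^ k) / 2 \<le> t ^ k"
  shows "(((x1 + y1) / 2) ^ k + ((x2 + y2) / 2) ^ k) / 2 \<le> ((s + t) / 2) ^ k"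
proof -
  have zero: "a = 0 \<and> b = 0" if "0 \<le> a" "0 \<le> b" "(a ^ k + b ^ k) / 2 \<le> 0 ^ k" for a b :: real
  proof -
    have "0 \<le> a ^ k" "0 \<le> b ^ k" "a ^ k + b ^ k \<le> 0"
      using that assms(7) by (auto simp: power_0_left)
    then have "a ^ k = 0" "b ^ k = 0" by linarith+
    then show ?thesis by simp
  qed
  have "((x1 + y1) ^ k + (x2 + y2) ^ k) / 2 \<le> (s + t) ^ k"
  proof (cases "s = 0 \<or> t = 0")
    case True
    then show ?thesis using zero[of x1 x2] zero[of y1 y2] assms by auto
  next
    case False
    define g h :: "(nat \<Rightarrow> real) \<Rightarrow> real"
      where "g = (\<lambda>e. if e 0 = 1 then x1 else x2)" and "h = (\<lambda>e. if e 0 = 1 then y1 else y2)"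
    show ?thesis
      using sign_mean_minkowski[of g h s t 1 "[0]" k "\<lambda>_. 0"] assms False
      by (auto simp: g_def h_def)
  qed
  then have "(((x1 + y1) ^ k + (x2 + y2) ^ k) / 2) / 2 ^ k \<le> (s + t) ^ k / 2 ^ k"
    by (intro divide_right_mono) auto
  then show ?thesis by (simp add: power_divide field_simps)
qed

text \<open>Tensorisation: by Minkowski, the L^k norm in coordinate \<open>i\<close> of an average
  over the others is at most the average of the L^k norms, so the two-point inequality survives
  averaging.\<close>

lemma sign_mean_two_point:
  assumes "\<And>e. 0 \<le> G e" "1 \<le> k" "i \<notin> set I"
    and "\<And>e. (G (e(i := \<rho>)) ^ k + G (e(i := - \<rho>)) ^ k) / 2 \<le> ((G (e(i := 1)) + G (e(i := - 1))) / 2) ^ k"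
  shows "(sign_mean 1 I G (e(i := \<rho>)) ^ k + sign_mean 1 I G (e(i := - \<rho>)) ^ k) / 2
    \<le> ((sign_mean 1 I G (e(i := 1)) + sign_mean 1 I G (e(i := - 1))) / 2) ^ k"
  using assms(3)
proof (induction I arbitrary: e)
  case Nil
  then show ?case using assms(4)[of e] by (simp only: sign_mean.simps)
next
  case (Cons j I)
  let ?m = "\<lambda>u v. sign_mean 1 I G (e(i := u, j := v))"
  have ij: "i \<noteq> j" "i \<notin> set I" using Cons.prems by auto
  have IH: "(?m \<rho> v ^ k + ?m (- \<rho>) v ^ k) / 2 \<le> ((?m 1 v + ?m (- 1) v) / 2) ^ k" for v
    using Cons.IH[of "e(j := v)", OF ij(2)] by (simp only: fun_upd_twist[OF ij(1)])
  have "(((?m \<rho> 1 + ?m \<rho> (- 1)) / 2) ^ k + ((?m (- \<rho>) 1 + ?m (- \<rho>) (- 1)) / 2) ^ k) / 2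
     \<le> (((?m 1 1 + ?m (- 1) 1) / 2 + (?m 1 (- 1) + ?m (- 1) (- 1)) / 2) / 2) ^ k"
    using assms(1,2) IH by (intro two_point_minkowski) (auto intro!: sign_mean_nonneg add_nonneg_nonneg)
  moreover have "(a + b) / 2 + (c + d) / 2 = (a + c) / 2 + (b + d) / 2" for a b c d :: real
    by (simp add: field_simps)
  ultimately show ?case
    by (simp only: sign_mean.simps)
qed

text \<open>For each value at \<open>i\<close> the induction hypothesis moves the coordinates in
  \<open>I\<close> from radius \<rho> to radius 1; the two-point inequality for the function already
  averaged over \<open>I\<close> then moves coordinate \<open>i\<close>.\<close>

lemma hypercontractivity:
  assumes "coord_convex \<phi>" "\<rho> = 1 / sqrt (real (2 * k))" "1 \<le> k" "distinct I"
  shows "sign_mean \<rho> I (\<lambda>e. \<phi> e ^ (2 * r * k)) e \<le> sign_mean 1 I (\<lambda>e. \<phi> e ^ (2 * r)) e ^ k"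
  using assms(4)
proof (induction I arbitrary: e)
  case (Cons i I)
  let ?G = "\<lambda>e. \<phi> e ^ (2 * r)"
  have "sign_mean \<rho> (i # I) (\<lambda>e. \<phi> e ^ (2 * r * k)) e
      \<le> (sign_mean 1 I ?G (e(i := \<rho>)) ^ k + sign_mean 1 I ?G (e(i := - \<rho>)) ^ k) / 2"
    unfolding sign_mean.simps using Cons.prems by (intro divide_right_mono add_mono Cons.IH) auto
  also have "\<dots> \<le> ((sign_mean 1 I ?G (e(i := 1)) + sign_mean 1 I ?G (e(i := - 1))) / 2) ^ k"
    using assms(3) Cons.prems two_point_convex[OF assms(1,2,3), of _ i r]
    by (intro sign_mean_two_point) (auto simp: power_mult coord_convex_nonneg[OF assms(1)])
  finally show ?case by simp
qed (simp add: power_mult)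

text \<open>Shrinking all signs by \<rho> multiplies a function homogeneous of degree
  \<open>d\<close> by \<open>\<rho> ^ d\<close>. After taking the root of order
  \<open>2 * r * k\<close>, the price is \<open>sqrt (2 * k) ^ d\<close>, which depends on the
  exponents only through their ratio \<open>k\<close>.\<close>

lemma hypercontractivity_homogeneous:
  assumes "coord_convex \<phi>" "1 \<le> k" "distinct I"
    and hom: "\<And>c e. 0 < c \<Longrightarrow> \<phi> (\<lambda>j. c * e j) = c ^ d * \<phi> e"
  shows "sign_mean 1 I (\<lambda>e. \<phi> e ^ (2 * r * k)) (\<lambda>_. 0)
    \<le> real (2 * k) ^ (r * k * d) * sign_mean 1 I (\<lambda>e. \<phi> e ^ (2 * r)) (\<lambda>_. 0) ^ k"
proof -
  define \<rho> where "\<rho> = 1 / sqrt (real (2 * k))"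
  have \<rho>: "0 < \<rho>" "\<rho>\<^sup>2 = 1 / real (2 * k)" using assms(2) by (auto simp: \<rho>_def power_divide)
  have "sign_mean \<rho> I (\<lambda>e. \<phi> e ^ (2 * r * k)) (\<lambda>_. 0)
      = sign_mean 1 I (\<lambda>e. (\<rho> ^ d) ^ (2 * r * k) * \<phi> e ^ (2 * r * k)) (\<lambda>_. 0)"
    using sign_mean_scale[of \<rho> I "\<lambda>e. \<phi> e ^ (2 * r * k)" "\<lambda>_. 0"] \<rho>(1)
    by (simp add: hom power_mult_distrib)
  also have "\<dots> = (\<rho>\<^sup>2) ^ (r * k * d) * sign_mean 1 I (\<lambda>e. \<phi> e ^ (2 * r * k)) (\<lambda>_. 0)"
    unfolding sign_mean_cmult by (simp add: power_mult[symmetric] ac_simps)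
  finally have "(\<rho>\<^sup>2) ^ (r * k * d) * sign_mean 1 I (\<lambda>e. \<phi> e ^ (2 * r * k)) (\<lambda>_. 0)
      \<le> sign_mean 1 I (\<lambda>e. \<phi> e ^ (2 * r)) (\<lambda>_. 0) ^ k"
    using hypercontractivity[OF assms(1) \<rho>_def assms(2,3), of r "\<lambda>_. 0"] by simp
  then show ?thesis
    using assms(2) unfolding \<rho>(2) by (simp add: power_divide field_simps)
qed

section \<open>Moments of the tail of a polynomial\<close>

lemma sign_mean_upt_mono:
  assumes "coord_convex \<phi>" "m \<le> m'"
  shows "sign_mean 1 [0..<m] \<phi> (\<lambda>_. 0) \<le> sign_mean 1 [0..<m'] \<phi> (\<lambda>_. 0)"
proof -
  have "sign_mean 1 [0..<m] \<phi> (\<lambda>_. 0) \<le> sign_mean 1 [0..<m] (sign_mean 1 [m..<m'] \<phi>) (\<lambda>_. 0)"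
    by (rule sign_mean_mono_on, rule le_sign_mean[OF assms(1)]) auto
  also have "\<dots> = sign_mean 1 [0..<m'] \<phi> (\<lambda>_. 0)"
    using assms(2) upt_add_eq_append[of 0 m "m' - m"] by (simp flip: sign_mean_append)
  finally show ?thesis .
qed

lemma sign_mean_truncate:
  assumes "set I \<subseteq> {..<n}"
  shows "sign_mean \<rho> I (\<lambda>e. g (\<lambda>j. if j < n then e j else 0)) e
    = sign_mean \<rho> I g (\<lambda>j. if j < n then e j else 0)"
  using assms
proof (induction I arbitrary: e)
  case (Cons i I)
  have upd: "(\<lambda>j. if j < n then (e(i := u)) j else 0) = (\<lambda>j. if j < n then e j else 0)(i := u)" for u
    using Cons.prems by auto
  have "sign_mean \<rho> I (\<lambda>e. g (\<lambda>j. if j < n then e j else 0)) (e(i := u))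
      = sign_mean \<rho> I g ((\<lambda>j. if j < n then e j else 0)(i := u))" for u
    using Cons.IH[of "e(i := u)"] Cons.prems unfolding upd by (simp only: list.set(2) insert_subset)
  then show ?case by (simp only: sign_mean.simps)
qed simp

text \<open>If the \<open>q\<close>-th moment hardly grows after the first \<open>n\<close> signs, then by uniform convexity
  \<open>\<phi>\<close> is \<open>L\<^sup>q\<close>-close to its truncation; averaging out the first \<open>n\<close> signs turns the truncation
  into a constant, its first moment.\<close>

lemma tail_moment_le:
  assumes \<phi>: "coord_convex \<phi>" and "n \<le> m" "2 \<le> q"
    and grow: "sign_mean 1 [0..<m] (\<lambda>e. \<phi> e ^ q) (\<lambda>_. 0) \<le> sign_mean 1 [0..<n] (\<lambda>e. \<phi> e ^ q) (\<lambda>_. 0) + 1"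
    and V: "sign_mean 1 [0..<n] \<phi> (\<lambda>_. 0) \<le> V"
  shows "sign_mean 1 [n..<m] (\<lambda>e. \<phi> e ^ q) (\<lambda>_. 0) \<le> 2 ^ q * (V ^ q + 1)"
proof -
  define H T where "H = [0..<n]" and "T = [n..<m]"
  have HT: "[0..<m] = H @ T" "set H \<inter> set T = {}" "set H \<subseteq> {..<n}" "distinct H" "distinct T"
    "\<And>j. j \<in> set H \<longleftrightarrow> j < n" "\<And>j. j \<in> set T \<Longrightarrow> \<not> j < n"
    using assms(2) upt_add_eq_append[of 0 n "m - n"] by (auto simp: H_def T_def)
  have nonneg: "0 \<le> \<phi> e" for e using \<phi> by (rule coord_convex_nonneg)
  define a where "a e = \<phi> (\<lambda>j. if j < n then e j else 0)" for e
  define D where "D e = \<bar>\<phi> e - a e\<bar> ^ q" for e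
  \<comment> \<open>For \<open>e\<close> carried by the first block, the linear term of the tangent
    at \<open>\<phi> e\<close> has nonnegative mean by Jensen. The distance to the truncation is
    thus paid for by the growth of the \<open>q\<close>-th moment.\<close>
  have step: "\<phi> e ^ q + sign_mean 1 T D e \<le> sign_mean 1 T (\<lambda>e. \<phi> e ^ q) e"
    if e: "\<And>j. j \<notin> set H \<Longrightarrow> e j = 0" for e
  proof -
    define c where "c = real q * \<phi> e ^ (q - 1)"
    have "c \<ge> 0" using nonneg by (simp add: c_def)
    have "\<phi> e \<le> sign_mean 1 T \<phi> e"
      using HT e by (intro le_sign_mean \<phi>) auto
    then have "c * \<phi> e \<le> c * sign_mean 1 T \<phi> e"
      using \<open>c \<ge> 0\<close> by (rule mult_left_mono)
    then have "\<phi> e ^ q + sign_mean 1 T D e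
        \<le> (\<phi> e ^ q - c * \<phi> e) + c * sign_mean 1 T \<phi> e + sign_mean 1 T D e"
      by simp
    also have "\<dots> = sign_mean 1 T (\<lambda>e'. ((\<phi> e ^ q - c * \<phi> e) + c * \<phi> e') + D e') e"
      by (simp only: sign_mean_add sign_mean_cmult sign_mean_const)
    also have "\<dots> \<le> sign_mean 1 T (\<lambda>e. \<phi> e ^ q) e"
    proof (rule sign_mean_mono_on)
      fix e' assume e': "\<And>j. j \<notin> set T \<Longrightarrow> e' j = e j"
      have "(\<lambda>j. if j < n then e' j else 0) = e"
        using e e' HT(6,7) by (auto simp: fun_eq_iff)
      then have "a e' = \<phi> e" by (simp add: a_def)
      then show "(\<phi> e ^ q - c * \<phi> e) + c * \<phi> e' + D e' \<le> \<phi> e' ^ q"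
        using power_tangent_gap[of "\<phi> e" "\<phi> e'" q] nonneg assms(3)
        by (simp add: D_def c_def algebra_simps)
    qed
    finally show ?thesis .
  qed
  have "sign_mean 1 H (\<lambda>e. \<phi> e ^ q + sign_mean 1 T D e) (\<lambda>_. 0)
      \<le> sign_mean 1 H (sign_mean 1 T (\<lambda>e. \<phi> e ^ q)) (\<lambda>_. 0)"
    by (rule sign_mean_mono_on) (rule step, simp)
  then have gap: "sign_mean 1 H (sign_mean 1 T D) (\<lambda>_. 0) \<le> 1"
    using grow unfolding HT(1) sign_mean_append sign_mean_add H_def[symmetric] by simp
  have V0: "0 \<le> V" using sign_mean_nonneg[of \<phi> 1 "[0..<n]" "\<lambda>_. 0"] nonneg V by simp
  \<comment> \<open>Now \<open>e\<close> is carried by the second block. Averaging over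
    \<open>H\<close> removes all dependence of the truncation on \<open>e\<close>, leaving the first
    moment, at most \<open>V\<close>, plus the averaged distance.\<close>
  have "\<phi> e ^ q \<le> 2 ^ q * (V ^ q + sign_mean 1 H D e)"
    if e: "\<And>j. j \<notin> set T \<Longrightarrow> e j = 0" for e
  proof -
    have "\<phi> e \<le> sign_mean 1 H \<phi> e"
      by (intro le_sign_mean \<phi> e HT(4)) (use HT(6,7) in blast)
    also have "\<dots> \<le> sign_mean 1 H (\<lambda>e. a e + \<bar>\<phi> e - a e\<bar>) e"
      by (rule sign_mean_mono) simp
    also have "\<dots> = sign_mean 1 H a e + sign_mean 1 H (\<lambda>e. \<bar>\<phi> e - a e\<bar>) e"
      by (rule sign_mean_add)
    also have "sign_mean 1 H a e = sign_mean 1 H \<phi> (\<lambda>j. if j < n then e j else 0)"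
      unfolding a_def using HT(3) by (rule sign_mean_truncate)
    also have "(\<lambda>j. if j < n then e j else 0) = (\<lambda>_. 0)"
      using e HT(6,7) by fastforce
    finally have "\<phi> e \<le> V + sign_mean 1 H (\<lambda>e. \<bar>\<phi> e - a e\<bar>) e"
      using V by (simp add: H_def)
    then have "\<phi> e ^ q \<le> (V + sign_mean 1 H (\<lambda>e. \<bar>\<phi> e - a e\<bar>) e) ^ q"
      using nonneg by (intro power_mono)
    also have "\<dots> \<le> 2 ^ q * (V ^ q + sign_mean 1 H (\<lambda>e. \<bar>\<phi> e - a e\<bar>) e ^ q)"
      using V0 by (intro add_power_le sign_mean_nonneg) auto
    also have "\<dots> \<le> 2 ^ q * (V ^ q + sign_mean 1 H D e)"
      unfolding D_def by (intro mult_left_mono add_left_mono sign_mean_power_le) auto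
    finally show ?thesis .
  qed
  then have "sign_mean 1 T (\<lambda>e. \<phi> e ^ q) (\<lambda>_. 0)
      \<le> sign_mean 1 T (\<lambda>e. 2 ^ q * (V ^ q + sign_mean 1 H D e)) (\<lambda>_. 0)"
    by (intro sign_mean_mono_on) simp
  also have "\<dots> = 2 ^ q * (V ^ q + sign_mean 1 T (sign_mean 1 H D) (\<lambda>_. 0))"
    by (simp only: sign_mean_cmult sign_mean_add sign_mean_const)
  also have "sign_mean 1 T (sign_mean 1 H D) (\<lambda>_. 0) = sign_mean 1 H (sign_mean 1 T D) (\<lambda>_. 0)"
    using HT(2) by (intro sign_mean_commute) auto
  also have "2 ^ q * (V ^ q + sign_mean 1 H (sign_mean 1 T D) (\<lambda>_. 0)) \<le> 2 ^ q * (V ^ q + 1)"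
    using gap by (intro mult_left_mono) auto
  finally show ?thesis by (simp add: T_def)
qed

section \<open>Multi-affine polynomials\<close>

definition multi_affine :: "((nat \<Rightarrow> real) \<Rightarrow> 'b::real_normed_vector) \<Rightarrow> bool" where
  "multi_affine F \<longleftrightarrow> (\<forall>e i u. F (e(i := u)) = F (e(i := 0)) + u *\<^sub>R (F (e(i := 1)) - F (e(i := 0))))"

text \<open>For multi-affine \<open>F\<close> this is the coefficient of variable \<open>i\<close>.
  It collects the terms containing that variable, with one degree less.\<close>

definition partial_diff :: "nat \<Rightarrow> ((nat \<Rightarrow> real) \<Rightarrow> 'b::real_normed_vector) \<Rightarrow> (nat \<Rightarrow> real) \<Rightarrow> 'b" where
  "partial_diff i F e = F (e(i := 1)) - F (e(i := 0))"

lemma multi_affineD: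
  "multi_affine F \<Longrightarrow> F (e(i := u)) = F (e(i := 0)) + u *\<^sub>R partial_diff i F e"
  unfolding multi_affine_def partial_diff_def by blast

lemma coord_convex_norm:
  assumes "multi_affine F"
  shows "coord_convex (\<lambda>e. norm (F e))"
  unfolding coord_convex_def
proof (intro conjI allI impI)
  fix e i and u :: real assume u: "\<bar>u\<bar> \<le> 1"
  have "F (e(i := u)) = ((1 + u) / 2) *\<^sub>R F (e(i := 1)) + ((1 - u) / 2) *\<^sub>R F (e(i := - 1))"
    unfolding multi_affineD[OF assms, of e i u] multi_affineD[OF assms, of e i 1] multi_affineD[OF assms, of e i "- 1"]
    by (simp add: algebra_simps flip: scaleR_add_left) (simp add: field_simps)
  then show "norm (F (e(i := u))) \<le> (1 + u) / 2 * norm (F (e(i := 1))) + (1 - u) / 2 * norm (F (e(i := - 1)))"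
    using norm_triangle_ineq[of "((1 + u) / 2) *\<^sub>R F (e(i := 1))" "((1 - u) / 2) *\<^sub>R F (e(i := - 1))"] u
    by auto
qed simp

lemma multi_affine_partial_diff:
  assumes "multi_affine F"
  shows "multi_affine (partial_diff i F)"
  unfolding multi_affine_def
proof (intro allI)
  fix e j and u :: real
  show "partial_diff i F (e(j := u)) = partial_diff i F (e(j := 0))
      + u *\<^sub>R (partial_diff i F (e(j := 1)) - partial_diff i F (e(j := 0)))"
  proof (cases "i = j")
    case True
    then show ?thesis by (simp add: partial_diff_def)
  next
    case False
    have F: "F (e(j := v, i := w)) = F (e(i := w, j := 0)) + v *\<^sub>R partial_diff j F (e(i := w))" for v w
      using multi_affineD[OF assms, of "e(i := w)" j v] fun_upd_twist[of j i e v w] False by simp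
    show ?thesis unfolding partial_diff_def[of i] F by (simp add: algebra_simps)
  qed
qed

text \<open>The affine expansion at \<open>u = c\<close> isolates \<open>c\<close> times the
  difference. The value with coordinate \<open>i\<close> zeroed scales by the full power, so
  subtracting it and cancelling one \<open>c\<close> lowers the degree.\<close>

lemma partial_diff_homogeneous:
  assumes "multi_affine F" "\<And>c e. 0 < c \<Longrightarrow> F (\<lambda>j. c * e j) = c ^ Suc d *\<^sub>R F e" "0 < c"
  shows "partial_diff i F (\<lambda>j. c * e j) = c ^ d *\<^sub>R partial_diff i F e"
proof -
  let ?ce = "\<lambda>j. c * e j"
  have "c ^ Suc d *\<^sub>R F (e(i := 1)) = F (?ce(i := c))"
    using assms(2)[OF assms(3), of "e(i := 1)"] by (simp add: fun_upd_def if_distrib cong: if_cong)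
  also have "\<dots> = F (?ce(i := 0)) + c *\<^sub>R partial_diff i F ?ce"
    by (rule multi_affineD[OF assms(1)])
  also have "F (?ce(i := 0)) = c ^ Suc d *\<^sub>R F (e(i := 0))"
    using assms(2)[OF assms(3), of "e(i := 0)"] by (simp add: fun_upd_def if_distrib cong: if_cong)
  finally have "c *\<^sub>R partial_diff i F ?ce = c *\<^sub>R (c ^ d *\<^sub>R partial_diff i F e)"
    unfolding partial_diff_def[of i F e] scaleR_scaleR power_Suc[symmetric] scaleR_diff_right
    by (simp only: add_diff_cancel_left')
  then show ?thesis using assms(3) by (simp only: scaleR_cancel_left) simp
qed

section \<open>Restoring signs one at a time\<close>

lemma sign_mean_Cons_upd:
  assumes "i \<notin> set I"
  shows "sign_mean \<rho> (i # I) g e = sign_mean \<rho> I (\<lambda>e. (1 / 2) * (g (e(i := \<rho>)) + g (e(i := - \<rho>)))) e"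
  unfolding sign_mean_cmult sign_mean_add using sign_mean_upd[OF assms] by (simp only: sign_mean.simps)

lemma partial_diff_second_moment_le:
  assumes "multi_affine F" "i \<notin> set I"
  shows "sign_mean 1 I (\<lambda>e. norm (partial_diff i F e) ^ 2) e \<le> sign_mean 1 (i # I) (\<lambda>e. norm (F e) ^ 2) e"
  unfolding sign_mean_Cons_upd[OF assms(2)]
proof (rule sign_mean_mono)
  fix e
  have eq: "partial_diff i F e = (1 / 2) *\<^sub>R (F (e(i := 1)) - F (e(i := - 1)))"
    unfolding multi_affineD[OF assms(1), of e i 1] multi_affineD[OF assms(1), of e i "- 1"]
    by (simp add: scaleR_2[symmetric])
  have "norm (partial_diff i F e) \<le> (norm (F (e(i := 1))) + norm (F (e(i := - 1)))) / 2"
    unfolding eq using norm_triangle_ineq4[of "F (e(i := 1))" "F (e(i := - 1))"] by simp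
  then have "norm (partial_diff i F e) ^ 2 \<le> ((norm (F (e(i := 1))) + norm (F (e(i := - 1)))) / 2) ^ 2"
    by (intro power_mono) auto
  also have "\<dots> \<le> (1 / 2) * (norm (F (e(i := 1))) ^ 2 + norm (F (e(i := - 1))) ^ 2)"
    using sum_squares_bound[of "norm (F (e(i := 1)))" "norm (F (e(i := - 1)))"]
    by (simp add: power_divide power2_sum)
  finally show "norm (partial_diff i F e) ^ 2 \<le> (1 / 2) * (norm (F (e(i := 1))) ^ 2 + norm (F (e(i := - 1))) ^ 2)" .
qed

text \<open>With coordinate \<open>i\<close> at zero, either sign adds at most the norm of the
  difference; Minkowski then adds the two L^p bounds.\<close>

lemma moment_add_sign_le:
  assumes "multi_affine F" "i \<notin> set I" "0 < s" "0 < c" "e i = 0"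
    and "sign_mean 1 I (\<lambda>e. norm (F e) ^ p) e \<le> s ^ p"
    and "sign_mean 1 I (\<lambda>e. norm (partial_diff i F e) ^ p) e \<le> c ^ p"
  shows "sign_mean 1 (i # I) (\<lambda>e. norm (F e) ^ p) e \<le> (s + c) ^ p"
proof -
  have "sign_mean 1 (i # I) (\<lambda>e. norm (F e) ^ p) e
      \<le> sign_mean 1 I (\<lambda>e. (norm (F e) + norm (partial_diff i F e)) ^ p) e"
    unfolding sign_mean_Cons_upd[OF assms(2)]
  proof (rule sign_mean_mono_on)
    fix e' assume "\<And>j. j \<notin> set I \<Longrightarrow> e' j = e j"
    then have "e'(i := 0) = e'" using assms(2,5) by auto
    then have "norm (F (e'(i := u))) ^ p \<le> (norm (F e') + norm (partial_diff i F e')) ^ p"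
      if "\<bar>u\<bar> = 1" for u
      using norm_triangle_ineq[of "F e'" "u *\<^sub>R partial_diff i F e'"] that
      unfolding multi_affineD[OF assms(1), of e' i u] by (intro power_mono) auto
    from this[of 1] this[of "- 1"]
    show "(1 / 2) * (norm (F (e'(i := 1))) ^ p + norm (F (e'(i := - 1))) ^ p)
        \<le> (norm (F e') + norm (partial_diff i F e')) ^ p" by simp
  qed
  also have "\<dots> \<le> (s + c) ^ p"
    using assms by (intro sign_mean_minkowski) auto
  finally show ?thesis .
qed

lemma moment_add_signs_le:
  assumes "multi_affine F" "0 < s" "0 < c" "n \<le> m"
    and "sign_mean 1 [n..<m] (\<lambda>e. norm (F e) ^ p) (\<lambda>_. 0) \<le> s ^ p"
    and diff: "\<And>i. i < n \<Longrightarrow> sign_mean 1 [Suc i..<m] (\<lambda>e. norm (partial_diff i F e) ^ p) (\<lambda>_. 0) \<le> c ^ p"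
  shows "sign_mean 1 [0..<m] (\<lambda>e. norm (F e) ^ p) (\<lambda>_. 0) \<le> (s + real n * c) ^ p"
proof -
  \<comment> \<open>Signs return in decreasing order of index, starting with \<open>n - 1\<close>.
    When index \<open>i\<close> returns, exactly \<open>[Suc i..<m]\<close> has been averaged, which
    is the block in \<open>diff\<close>.\<close>
  have "sign_mean 1 [n - i..<m] (\<lambda>e. norm (F e) ^ p) (\<lambda>_. 0) \<le> (s + real i * c) ^ p" if "i \<le> n" for i
    using that
  proof (induction i)
    case (Suc i)
    have eq: "[n - Suc i..<m] = (n - Suc i) # [n - i..<m]" "Suc (n - Suc i) = n - i"
      using Suc.prems assms(4) by (auto simp: upt_conv_Cons Suc_diff_Suc)
    have "sign_mean 1 [n - Suc i..<m] (\<lambda>e. norm (F e) ^ p) (\<lambda>_. 0) \<le> (s + real i * c + c) ^ p"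
      unfolding eq(1) using Suc assms(2,3) diff[of "n - Suc i"] unfolding eq(2)
      by (intro moment_add_sign_le assms(1)) (auto simp: add_pos_nonneg)
    then show ?case by (simp add: algebra_simps)
  qed (use assms(5) in simp)
  from this[of n] show ?thesis by simp
qed

section \<open>Moments of partial sums\<close>

text \<open>Free real variables in place of the signs, so that they can be zeroed and
  scaled.\<close>

definition chaos_poly :: "nat \<Rightarrow> (nat list \<Rightarrow> 'b::real_normed_vector) \<Rightarrow> nat \<Rightarrow> (nat \<Rightarrow> real) \<Rightarrow> 'b" where
  "chaos_poly d x n e = (\<Sum>is | length is = d \<and> set is \<subseteq> {..<n}. (\<Prod>i\<leftarrow>is. e i) *\<^sub>R x is)"

lemma finite_multi_indices: "finite {is :: nat list. length is = d \<and> set is \<subseteq> {..<n}}"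
  using finite_lists_length_eq[of "{..<n}" d] by (simp add: conj_commute)

lemma blinfun_chaos_poly:
  "blinfun_apply f (chaos_poly d x n (\<lambda>i. \<epsilon> i \<omega>)) = chaos_partial_sum d (\<lambda>is. blinfun_apply f (x is)) \<epsilon> n \<omega>"
  by (simp add: chaos_poly_def chaos_partial_sum_def blinfun.sum_right blinfun.scaleR_right mult.commute)

lemma chaos_poly_cong: "(\<And>j. j < n \<Longrightarrow> e j = e' j) \<Longrightarrow> chaos_poly d x n e = chaos_poly d x n e'"
  unfolding chaos_poly_def by (intro sum.cong refl arg_cong2[where f = scaleR] arg_cong[where f = prod_list] map_cong) auto

lemma chaos_poly_extend:
  assumes "n \<le> m" "\<And>j. n \<le> j \<Longrightarrow> e j = 0"
  shows "chaos_poly d x m e = chaos_poly d x n e"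
  unfolding chaos_poly_def
proof (rule sum.mono_neutral_right)
  show "\<forall>is\<in>{is. length is = d \<and> set is \<subseteq> {..<m}} - {is. length is = d \<and> set is \<subseteq> {..<n}}.
      (\<Prod>i\<leftarrow>is. e i) *\<^sub>R x is = 0"
  proof
    fix "is" assume "is \<in> {is. length is = d \<and> set is \<subseteq> {..<m}} - {is. length is = d \<and> set is \<subseteq> {..<n}}"
    then obtain j where "j \<in> set is" "n \<le> j" by fastforce
    then have "(\<Prod>i\<leftarrow>is. e i) = 0" using assms(2)[of j] by (force simp: prod_list_zero_iff)
    then show "(\<Prod>i\<leftarrow>is. e i) *\<^sub>R x is = 0" by simp
  qed
qed (use assms(1) finite_multi_indices in auto)

lemma chaos_poly_scale: "chaos_poly d x n (\<lambda>j. c * e j) = c ^ d *\<^sub>R chaos_poly d x n e"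
proof -
  have "(\<Prod>i\<leftarrow>is. c * e i) = c ^ length is * (\<Prod>i\<leftarrow>is. e i)" for "is"
    by (induction "is") auto
  then show ?thesis by (simp add: chaos_poly_def scaleR_sum_right)
qed

lemma prod_list_affine:
  fixes e :: "nat \<Rightarrow> real"
  assumes "distinct is"
  shows "prod_list (map (e(i := u)) is) = prod_list (map (e(i := 0)) is)
    + u * (prod_list (map (e(i := 1)) is) - prod_list (map (e(i := 0)) is))"
  using assms
proof (induction "is")
  case (Cons j js)
  show ?case
  proof (cases "i = j")
    case True
    then have "map (e(i := v)) js = map e js" for v
      using Cons.prems by auto
    then show ?thesis unfolding True list.map prod_list.Cons by (simp only: fun_upd_same) simp
  next
    case False
    then have eq: "prod_list (map (e(i := v)) (j # js)) = e j * prod_list (map (e(i := v)) js)" for v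
      unfolding list.map prod_list.Cons by (simp only: fun_upd_other)
    have "distinct js" using Cons.prems by simp
    note IH = Cons.IH[OF this]
    show ?thesis unfolding eq by (subst IH) (simp only: algebra_simps)
  qed
qed simp

lemma multi_affine_chaos_poly:
  assumes "symmetric_tetrahedral d x"
  shows "multi_affine (chaos_poly d x n)"
  unfolding multi_affine_def
proof (intro allI)
  fix e i and u :: real
  have "prod_list (map (e(i := u)) is) *\<^sub>R x is = prod_list (map (e(i := 0)) is) *\<^sub>R x is
      + u *\<^sub>R (prod_list (map (e(i := 1)) is) *\<^sub>R x is - prod_list (map (e(i := 0)) is) *\<^sub>R x is)"
    if "length is = d" for "is"
  proof (cases "x is = 0")
    case False
    then have "distinct is" using assms that by (auto simp: symmetric_tetrahedral_def)
    then show ?thesis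
      by (subst prod_list_affine) (simp_all add: algebra_simps)
  qed simp
  then show "chaos_poly d x n (e(i := u)) = chaos_poly d x n (e(i := 0))
      + u *\<^sub>R (chaos_poly d x n (e(i := 1)) - chaos_poly d x n (e(i := 0)))"
    unfolding chaos_poly_def sum_subtractf[symmetric] scaleR_sum_right sum.distrib[symmetric]
    by (intro sum.cong) auto
qed

definition chaos_moment :: "nat \<Rightarrow> (nat list \<Rightarrow> 'b::real_normed_vector) \<Rightarrow> nat \<Rightarrow> nat \<Rightarrow> real" where
  "chaos_moment d x p m = sign_mean 1 [0..<m] (\<lambda>e. norm (chaos_poly d x m e) ^ p) (\<lambda>_. 0)"

text \<open>Zeroing the variables from \<open>m\<close> on turns the longer partial sum into the
  shorter one, so a single polynomial carries the moments of all shorter partial sums.\<close>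

lemma chaos_moment_extend:
  assumes "m \<le> M"
  shows "sign_mean 1 [0..<m] (\<lambda>e. norm (chaos_poly d x M e) ^ p) (\<lambda>_. 0) = chaos_moment d x p m"
  unfolding chaos_moment_def
proof (rule sign_mean_cong_on)
  fix e :: "nat \<Rightarrow> real" assume "\<And>j. j \<notin> set [0..<m] \<Longrightarrow> e j = (\<lambda>_. 0) j"
  then show "norm (chaos_poly d x M e) ^ p = norm (chaos_poly d x m e) ^ p"
    using assms by (subst chaos_poly_extend[of m M]) auto
qed

lemma hypercontractivity_norm:
  assumes "multi_affine F" "1 \<le> k" "distinct I" "0 \<le> s"
    and hom: "\<And>c e. 0 < c \<Longrightarrow> F (\<lambda>j. c * e j) = c ^ d *\<^sub>R F e"
    and "sign_mean 1 I (\<lambda>e. norm (F e) ^ (2 * r)) (\<lambda>_. 0) \<le> s ^ (2 * r)"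
  shows "sign_mean 1 I (\<lambda>e. norm (F e) ^ (2 * r * k)) (\<lambda>_. 0) \<le> (sqrt (real (2 * k)) ^ d * s) ^ (2 * r * k)"
proof -
  have "sign_mean 1 I (\<lambda>e. norm (F e) ^ (2 * r * k)) (\<lambda>_. 0)
      \<le> real (2 * k) ^ (r * k * d) * sign_mean 1 I (\<lambda>e. norm (F e) ^ (2 * r)) (\<lambda>_. 0) ^ k"
    using assms(2,3) hom by (intro hypercontractivity_homogeneous coord_convex_norm assms(1)) auto
  also have "\<dots> \<le> real (2 * k) ^ (r * k * d) * (s ^ (2 * r)) ^ k"
    using assms(6) by (intro mult_left_mono power_mono sign_mean_nonneg) auto
  also have "real (2 * k) = sqrt (real (2 * k)) ^ 2" by simp
  finally show ?thesis
    by (simp only: power_mult_distrib power_mult[symmetric] mult.commute mult.left_commute mult.assoc)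
qed

text \<open>The decisive point is that \<open>2 * (2 + V\<^sup>2)\<close> is free of
  \<open>r\<close>, although \<open>n\<close> depends on \<open>r\<close>: the tail is estimated
  from exponent \<open>2 * r\<close> and pays only for the ratio \<open>k\<close>. Each restored
  sign brings a polynomial of degree \<open>d - 1\<close>, estimated from exponent 2.\<close>

lemma chaos_moment_le:
  assumes x: "symmetric_tetrahedral d x" and "1 \<le> d" "0 < V"
    and V: "\<And>m. chaos_moment d x 2 m \<le> V\<^sup>2"
    and "1 \<le> r"
  shows "\<exists>n. \<forall>m\<ge>n. \<forall>k\<ge>1. chaos_moment d x (2 * r * k) m
    \<le> (sqrt (real (2 * k)) ^ d * (2 * (2 + V\<^sup>2)) + real n * (sqrt (real (2 * r * k)) ^ (d - 1) * V)) ^ (2 * r * k)"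
proof -
  note affine = multi_affine_chaos_poly[OF x]
  note convex = coord_convex_norm[OF affine]
  define q where "q = 2 * r"
  have "chaos_moment d x q m \<le> (sqrt (real (2 * r)) ^ d * V) ^ q" for m
    using hypercontractivity_norm[OF affine[of m], of r "[0..<m]" V d 1] V[of m] assms(3,5)
    by (simp add: chaos_moment_def q_def chaos_poly_scale)
  then have bdd: "bdd_above (range (chaos_moment d x q))" by (intro bdd_aboveI2)
  have "(SUP m. chaos_moment d x q m) - 1 < (SUP m. chaos_moment d x q m)" by simp
  \<comment> \<open>At this \<open>n\<close> the bounded \<open>q\<close>-th moments are within 1 of
    their supremum, so no other partial sum exceeds it by more than 1.\<close>
  then obtain n where n: "(SUP m. chaos_moment d x q m) - 1 < chaos_moment d x q n"
    using less_cSUP_iff[OF _ bdd] by blast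
  have grow: "chaos_moment d x q m \<le> chaos_moment d x q n + 1" for m
    using n cSUP_upper[OF _ bdd, of m] by simp
  have "chaos_moment d x (2 * r * k) m \<le> (sqrt (real (2 * k)) ^ d * (2 * (2 + V\<^sup>2))
      + real n * (sqrt (real (2 * r * k)) ^ (d - 1) * V)) ^ (2 * r * k)" if "n \<le> m" "1 \<le> k" for m k
  proof -
    let ?F = "chaos_poly d x m"
    have hom: "?F (\<lambda>j. c * e j) = c ^ Suc (d - 1) *\<^sub>R ?F e" for c e
      using assms(2) by (simp add: chaos_poly_scale del: power_Suc)
    \<comment> \<open>The tail estimate involves the head only through its first moment, which the
      second moment bounds independently of \<open>q\<close>.\<close>
    have "sign_mean 1 [0..<n] (\<lambda>e. norm (?F e)) (\<lambda>_. 0) \<le> sign_mean 1 [0..<n] (\<lambda>e. 1 + norm (?F e) ^ 2) (\<lambda>_. 0)"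
    proof (rule sign_mean_mono)
      show "norm (?F e) \<le> 1 + norm (?F e) ^ 2" for e
        using sum_squares_bound[of 1 "norm (?F e)"] norm_ge_zero[of "?F e"] by (simp del: norm_ge_zero)
    qed
    also have "\<dots> = 1 + chaos_moment d x 2 n"
      by (simp only: sign_mean_add sign_mean_const chaos_moment_extend[OF that(1)])
    also have "\<dots> \<le> 1 + V\<^sup>2" using V by simp
    finally have "sign_mean 1 [n..<m] (\<lambda>e. norm (?F e) ^ q) (\<lambda>_. 0) \<le> 2 ^ q * ((1 + V\<^sup>2) ^ q + 1)"
      using that grow[of m] assms(5) unfolding chaos_moment_extend[OF that(1), symmetric]
      by (intro tail_moment_le convex) (auto simp: q_def chaos_moment_def)
    also have "\<dots> \<le> 2 ^ q * (1 + V\<^sup>2 + 1) ^ q"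
      using power_add_superadditive[of "1 + V\<^sup>2" 1 q] assms(5) by (intro mult_left_mono) (auto simp: q_def)
    finally have "sign_mean 1 [n..<m] (\<lambda>e. norm (?F e) ^ q) (\<lambda>_. 0) \<le> (2 * (2 + V\<^sup>2)) ^ q"
      by (simp add: power_mult_distrib[symmetric] algebra_simps)
    then have tail: "sign_mean 1 [n..<m] (\<lambda>e. norm (?F e) ^ (2 * r * k)) (\<lambda>_. 0)
        \<le> (sqrt (real (2 * k)) ^ d * (2 * (2 + V\<^sup>2))) ^ (2 * r * k)"
      using that by (intro hypercontractivity_norm affine) (auto simp: q_def chaos_poly_scale)
    have "sign_mean 1 [Suc i..<m] (\<lambda>e. norm (partial_diff i ?F e) ^ (2 * r * k)) (\<lambda>_. 0)
        \<le> (sqrt (real (2 * r * k)) ^ (d - 1) * V) ^ (2 * r * k)" if "i < n" for i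
    proof -
      \<comment> \<open>The difference is controlled by the polynomial with sign \<open>i\<close>
        restored; restoring the signs below \<open>i\<close> too only raises the mean.\<close>
      have "sign_mean 1 [Suc i..<m] (\<lambda>e. norm (partial_diff i ?F e) ^ 2) (\<lambda>_. 0)
          \<le> sign_mean 1 (i # [Suc i..<m]) (\<lambda>e. norm (?F e) ^ 2) (\<lambda>_. 0)"
        by (rule partial_diff_second_moment_le[OF affine]) simp
      also have "i # [Suc i..<m] = [i..<m]"
        using that \<open>n \<le> m\<close> by (simp add: upt_conv_Cons)
      also have "sign_mean 1 [i..<m] (\<lambda>e. norm (?F e) ^ 2) (\<lambda>_. 0)
          \<le> sign_mean 1 [i..<m] (sign_mean 1 [0..<i] (\<lambda>e. norm (?F e) ^ 2)) (\<lambda>_. 0)"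
        by (rule sign_mean_mono_on, rule le_sign_mean[OF coord_convex_power[OF convex]]) auto
      also have "\<dots> = sign_mean 1 [0..<i] (sign_mean 1 [i..<m] (\<lambda>e. norm (?F e) ^ 2)) (\<lambda>_. 0)"
        by (rule sign_mean_commute) auto
      also have "\<dots> = chaos_moment d x 2 m"
        using that \<open>n \<le> m\<close> upt_add_eq_append[of 0 i "m - i"]
        by (simp add: chaos_moment_def flip: sign_mean_append)
      also have "\<dots> \<le> V ^ (2 * 1)" using V by simp
      finally have "sign_mean 1 [Suc i..<m] (\<lambda>e. norm (partial_diff i ?F e) ^ (2 * 1 * (r * k))) (\<lambda>_. 0)
          \<le> (sqrt (real (2 * (r * k))) ^ (d - 1) * V) ^ (2 * 1 * (r * k))"
        using assms(3,5) \<open>1 \<le> k\<close>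
        by (intro hypercontractivity_norm multi_affine_partial_diff affine partial_diff_homogeneous hom) auto
      then show ?thesis by (simp add: mult.assoc)
    qed
    then have "sign_mean 1 [0..<m] (\<lambda>e. norm (?F e) ^ (2 * r * k)) (\<lambda>_. 0)
        \<le> (sqrt (real (2 * k)) ^ d * (2 * (2 + V\<^sup>2)) + real n * (sqrt (real (2 * r * k)) ^ (d - 1) * V)) ^ (2 * r * k)"
      using that assms(3,5) tail
      by (intro moment_add_signs_le affine) (auto intro!: mult_pos_pos add_pos_nonneg)
    then show ?thesis by (simp add: chaos_moment_def)
  qed
  then show ?thesis by blast
qed

section \<open>The law of the chaos\<close>

lemma prob_sign_pattern:
  assumes "prob_space N" "prob_space.indep_vars N (\<lambda>_. borel) \<sigma> UNIV"
    and half: "\<And>i v. v \<in> {1, - 1 :: real} \<Longrightarrow> measure N {\<omega> \<in> space N. \<sigma> i \<omega> = v} = 1 / 2"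
    and "finite J" "\<And>j. s j \<in> {1, - 1}"
  shows "measure N {\<omega> \<in> space N. \<forall>j\<in>J. \<sigma> j \<omega> = s j} = (1 / 2) ^ card J"
proof (cases "J = {}")
  case True
  then show ?thesis using prob_space.prob_space[OF assms(1)] by simp
next
  case False
  have eq: "\<sigma> j -` {s j} \<inter> space N = {\<omega> \<in> space N. \<sigma> j \<omega> = s j}" for j by auto
  have "{\<omega> \<in> space N. \<forall>j\<in>J. \<sigma> j \<omega> = s j} = (\<Inter>j\<in>J. \<sigma> j -` {s j} \<inter> space N)"
    using False by auto
  also have "measure N \<dots> = (\<Prod>j\<in>J. measure N (\<sigma> j -` {s j} \<inter> space N))"
    using False assms(4) by (intro prob_space.indep_varsD[OF assms(1,2)]) auto
  also have "\<dots> = (\<Prod>j\<in>J. 1 / 2)"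
    unfolding eq using half assms(5) by (intro prod.cong) auto
  finally show ?thesis by simp
qed

text \<open>The function \<open>g\<close> is arbitrary: only finitely many signs enter, so splitting
  on each of them leaves a function with finitely many values on measurable events.\<close>

lemma measurable_sign_composition:
  assumes meas: "\<And>i. \<sigma> i \<in> borel_measurable N" and val: "\<And>i \<omega>. \<sigma> i \<omega> \<in> {1, - 1 :: real}"
  shows "(\<lambda>\<omega>. ennreal (g (\<lambda>i. if i \<in> set I then \<sigma> i \<omega> else e i))) \<in> borel_measurable N"
proof (induction I arbitrary: e)
  case (Cons i I)
  let ?h = "\<lambda>u \<omega>. ennreal (g (\<lambda>j. if j \<in> set I then \<sigma> j \<omega> else (e(i := u)) j))"
  have upd: "(\<lambda>j. if j \<in> set (i # I) then \<sigma> j \<omega> else e j)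
      = (\<lambda>j. if j \<in> set I then \<sigma> j \<omega> else (e(i := \<sigma> i \<omega>)) j)" for \<omega>
    by auto
  have "(\<lambda>\<omega>. ennreal (g (\<lambda>j. if j \<in> set (i # I) then \<sigma> j \<omega> else e j)))
      = (\<lambda>\<omega>. if \<sigma> i \<omega> = 1 then ?h 1 \<omega> else ?h (- 1) \<omega>)"
  proof
    fix \<omega>
    consider "\<sigma> i \<omega> = 1" | "\<sigma> i \<omega> = - 1" "\<sigma> i \<omega> \<noteq> 1" using val[of i \<omega>] by auto
    then show "ennreal (g (\<lambda>j. if j \<in> set (i # I) then \<sigma> j \<omega> else e j))
        = (if \<sigma> i \<omega> = 1 then ?h 1 \<omega> else ?h (- 1) \<omega>)"
      unfolding upd by cases (simp_all only: if_True if_False simp_thms)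
  qed
  also have "\<dots> \<in> borel_measurable N"
  proof (rule measurable_If)
    show "?h 1 \<in> borel_measurable N" "?h (- 1) \<in> borel_measurable N" by (rule Cons.IH)+
    show "{\<omega> \<in> space N. \<sigma> i \<omega> = 1} \<in> sets N" using meas by measurable
  qed
  finally show ?case .
qed simp

text \<open>Carrying the indicator of the pattern already revealed on \<open>J\<close> turns the
  induction into a case split on the next sign. Independence enters only at the end, through the
  probability of a full pattern.\<close>

lemma nn_integral_sign_mean_restricted:
  assumes N: "prob_space N" "prob_space.indep_vars N (\<lambda>_. borel) \<sigma> UNIV"
    and half: "\<And>i v. v \<in> {1, - 1 :: real} \<Longrightarrow> measure N {\<omega> \<in> space N. \<sigma> i \<omega> = v} = 1 / 2"
    and val: "\<And>i \<omega>. \<sigma> i \<omega> \<in> {1, - 1}"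
    and g: "\<And>e. 0 \<le> g e"
    and "finite J" "\<And>j. s j \<in> {1, - 1}" "distinct I" "set I \<inter> J = {}"
  shows "(\<integral>\<^sup>+ \<omega>. indicator {\<omega> \<in> space N. \<forall>j\<in>J. \<sigma> j \<omega> = s j} \<omega>
      * ennreal (g (\<lambda>i. if i \<in> set I then \<sigma> i \<omega> else e i)) \<partial>N)
    = ennreal ((1 / 2) ^ card J * sign_mean 1 I g e)"
proof -
  have meas: "\<sigma> i \<in> borel_measurable N" for i
    using N unfolding prob_space.indep_vars_def2[OF N(1)] by auto
  note comp = measurable_sign_composition[OF meas val, of g]
  have A: "{\<omega> \<in> space N. \<forall>j\<in>J. \<sigma> j \<omega> = s j} \<in> sets N" if "finite J" for J and s :: "nat \<Rightarrow> real"
  proof -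
    note [measurable] = meas
    show ?thesis using that by measurable
  qed
  interpret prob_space N by (rule N)
  show ?thesis
    using assms(6-)
  proof (induction I arbitrary: J s e)
    case Nil
    then show ?case
      using A[OF Nil(1), of s] prob_sign_pattern[OF N half, of J s] g
      by (simp add: nn_integral_multc emeasure_eq_measure ennreal_mult)
  next
    case (Cons i I)
    define P where "P u = {\<omega> \<in> space N. \<forall>j\<in>insert i J. \<sigma> j \<omega> = (s(i := u)) j}" for u :: real
    let ?h = "\<lambda>u \<omega>. ennreal (g (\<lambda>j. if j \<in> set I then \<sigma> j \<omega> else (e(i := u)) j))"
    have P: "P u \<in> sets N" for u unfolding P_def using Cons.prems by (intro A) auto
    have upd: "(\<lambda>j. if j \<in> set (i # I) then \<sigma> j \<omega> else e j)
      = (\<lambda>j. if j \<in> set I then \<sigma> j \<omega> else (e(i := \<sigma> i \<omega>)) j)" for \<omega>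
      by auto
    have IH: "(\<integral>\<^sup>+ \<omega>. indicator (P u) \<omega> * ?h u \<omega> \<partial>N)
        = ennreal ((1 / 2) ^ card (insert i J) * sign_mean 1 I g (e(i := u)))" if "u \<in> {1, - 1}" for u
      unfolding P_def using Cons.prems that by (intro Cons.IH) auto
    have "(\<integral>\<^sup>+ \<omega>. indicator {\<omega> \<in> space N. \<forall>j\<in>J. \<sigma> j \<omega> = s j} \<omega>
        * ennreal (g (\<lambda>j. if j \<in> set (i # I) then \<sigma> j \<omega> else e j)) \<partial>N)
      = (\<integral>\<^sup>+ \<omega>. indicator (P 1) \<omega> * ?h 1 \<omega> + indicator (P (- 1)) \<omega> * ?h (- 1) \<omega> \<partial>N)"
    proof (rule nn_integral_cong)
      fix \<omega> assume "\<omega> \<in> space N"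
      then have "\<omega> \<in> P u \<longleftrightarrow> \<omega> \<in> {\<omega> \<in> space N. \<forall>j\<in>J. \<sigma> j \<omega> = s j} \<and> \<sigma> i \<omega> = u" for u
        using Cons.prems by (auto simp: P_def)
      then have P_iff: "indicator (P u) \<omega> = (if \<sigma> i \<omega> = u then indicator {\<omega> \<in> space N. \<forall>j\<in>J. \<sigma> j \<omega> = s j} \<omega> else 0 :: ennreal)" for u
        by (simp add: indicator_def)
      consider "\<sigma> i \<omega> = 1" | "\<sigma> i \<omega> = - 1" using val[of i \<omega>] by auto
      then show "indicator {\<omega> \<in> space N. \<forall>j\<in>J. \<sigma> j \<omega> = s j} \<omega>
          * ennreal (g (\<lambda>j. if j \<in> set (i # I) then \<sigma> j \<omega> else e j))
        = indicator (P 1) \<omega> * ?h 1 \<omega> + indicator (P (- 1)) \<omega> * ?h (- 1) \<omega>"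
      proof cases
        case 1
        show ?thesis unfolding upd P_iff 1 by simp
      next
        case 2
        show ?thesis unfolding upd P_iff 2 by simp
      qed
    qed
    also have "\<dots> = (\<integral>\<^sup>+ \<omega>. indicator (P 1) \<omega> * ?h 1 \<omega> \<partial>N) + (\<integral>\<^sup>+ \<omega>. indicator (P (- 1)) \<omega> * ?h (- 1) \<omega> \<partial>N)"
      by (intro nn_integral_add borel_measurable_times_ennreal borel_measurable_indicator P comp)
    also have "\<dots> = ennreal ((1 / 2) ^ card J * sign_mean 1 (i # I) g e)"
      using Cons.prems sign_mean_nonneg[of g] g
      by (simp add: IH ennreal_plus[symmetric] field_simps del: ennreal_plus)
    finally show ?case .
  qed
qed

lemma rademacher_AE:
  assumes "rademacher_sequence N \<epsilon>"
  shows "AE \<omega> in N. \<forall>i. \<epsilon> i \<omega> = 1 \<or> \<epsilon> i \<omega> = - 1"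
proof -
  have N: "prob_space N" "prob_space.indep_vars N (\<lambda>_. borel) \<epsilon> UNIV"
    and half: "measure N {\<omega> \<in> space N. \<epsilon> i \<omega> = 1} = 1 / 2" "measure N {\<omega> \<in> space N. \<epsilon> i \<omega> = - 1} = 1 / 2" for i
    using assms by (auto simp: rademacher_sequence_def)
  interpret prob_space N by (rule N)
  have [measurable]: "\<epsilon> i \<in> borel_measurable N" for i
    using N(2) unfolding indep_vars_def2 by auto
  have "AE \<omega> in N. \<epsilon> i \<omega> = 1 \<or> \<epsilon> i \<omega> = - 1" for i
  proof (rule AE_I_eq_1)
    have "{\<omega> \<in> space N. \<epsilon> i \<omega> = 1 \<or> \<epsilon> i \<omega> = - 1} = {\<omega> \<in> space N. \<epsilon> i \<omega> = 1} \<union> {\<omega> \<in> space N. \<epsilon> i \<omega> = - 1}" by auto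
    also have "prob \<dots> = prob {\<omega> \<in> space N. \<epsilon> i \<omega> = 1} + prob {\<omega> \<in> space N. \<epsilon> i \<omega> = - 1}"
      by (rule finite_measure_Union) auto
    finally show "emeasure N {\<omega> \<in> space N. \<epsilon> i \<omega> = 1 \<or> \<epsilon> i \<omega> = - 1} = 1"
      using half by (simp add: emeasure_eq_measure)
  qed measurable
  then show ?thesis by (simp add: AE_all_countable)
qed

lemma nn_integral_rademacher:
  assumes "rademacher_sequence N \<epsilon>" "\<And>e. 0 \<le> g e"
    and cong: "\<And>e e'. (\<And>j. j < m \<Longrightarrow> e j = e' j) \<Longrightarrow> g e = g e'"
  shows "(\<integral>\<^sup>+ \<omega>. ennreal (g (\<lambda>i. \<epsilon> i \<omega>)) \<partial>N) = ennreal (sign_mean 1 [0..<m] g (\<lambda>_. 0))"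
proof -
  have N: "prob_space N" "prob_space.indep_vars N (\<lambda>_. borel) \<epsilon> UNIV"
    and half: "measure N {\<omega> \<in> space N. \<epsilon> i \<omega> = 1} = 1 / 2" for i
    using assms(1) by (auto simp: rademacher_sequence_def)
  interpret prob_space N by (rule N)
  have [measurable]: "\<epsilon> i \<in> borel_measurable N" for i
    using N(2) unfolding indep_vars_def2 by auto
  \<comment> \<open>The variables \<open>\<epsilon> i\<close> are signs only almost surely; this
    version takes the values 1 and -1 everywhere.\<close>
  define \<sigma> where "\<sigma> i \<omega> = (if \<epsilon> i \<omega> = 1 then 1 else - 1 :: real)" for i \<omega>
  have indep: "prob_space.indep_vars N (\<lambda>_. borel) \<sigma> UNIV"
    using indep_vars_compose2[OF N(2), of "\<lambda>_ x. if x = 1 then 1 else - 1" "\<lambda>_. borel"]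
    unfolding \<sigma>_def[abs_def] by simp
  have val: "\<sigma> i \<omega> \<in> {1, - 1}" for i \<omega> by (simp add: \<sigma>_def)
  have \<sigma>_half: "prob {\<omega> \<in> space N. \<sigma> i \<omega> = v} = 1 / 2" if "v \<in> {1, - 1}" for i v
  proof -
    have "{\<omega> \<in> space N. \<sigma> i \<omega> = 1} = {\<omega> \<in> space N. \<epsilon> i \<omega> = 1}"
      "{\<omega> \<in> space N. \<sigma> i \<omega> = - 1} = space N - {\<omega> \<in> space N. \<epsilon> i \<omega> = 1}"
      by (auto simp: \<sigma>_def)
    moreover have "prob (space N - {\<omega> \<in> space N. \<epsilon> i \<omega> = 1}) = 1 / 2"
      using half[of i] by (subst prob_compl) auto
    ultimately show ?thesis using that half[of i] by auto
  qed
  have "(\<integral>\<^sup>+ \<omega>. ennreal (g (\<lambda>i. \<epsilon> i \<omega>)) \<partial>N)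
      = (\<integral>\<^sup>+ \<omega>. indicator {\<omega> \<in> space N. \<forall>j\<in>{}. \<sigma> j \<omega> = 1} \<omega>
        * ennreal (g (\<lambda>i. if i \<in> set [0..<m] then \<sigma> i \<omega> else 0)) \<partial>N)"
  proof (rule nn_integral_cong_AE)
    show "AE \<omega> in N. ennreal (g (\<lambda>i. \<epsilon> i \<omega>)) = indicator {\<omega> \<in> space N. \<forall>j\<in>{}. \<sigma> j \<omega> = 1} \<omega>
        * ennreal (g (\<lambda>i. if i \<in> set [0..<m] then \<sigma> i \<omega> else 0))"
      using rademacher_AE[OF assms(1)] AE_space
    proof eventually_elim
      case (elim \<omega>)
      then have "\<sigma> i \<omega> = \<epsilon> i \<omega>" for i by (auto simp: \<sigma>_def dest: spec[of _ i])
      then have "g (\<lambda>i. \<epsilon> i \<omega>) = g (\<lambda>i. if i \<in> set [0..<m] then \<sigma> i \<omega> else 0)"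
        by (intro cong) simp
      then show ?case using elim by simp
    qed
  qed
  also have "\<dots> = ennreal ((1 / 2) ^ card ({} :: nat set) * sign_mean 1 [0..<m] g (\<lambda>_. 0))"
    by (rule nn_integral_sign_mean_restricted[OF N(1) indep \<sigma>_half val assms(2)]) simp_all
  finally show ?thesis by simp
qed

text \<open>Paley-Zygmund: a fourth moment comparable to the squared second moment prevents the
  second moment from living on an event of small probability.\<close>

lemma second_moment_le_of_fourth:
  assumes nonneg: "\<And>e. 0 \<le> \<phi> e" and "0 < C"
    and fourth: "sign_mean 1 I (\<lambda>e. \<phi> e ^ 4) e \<le> C * (sign_mean 1 I (\<lambda>e. \<phi> e ^ 2) e)\<^sup>2"
    and small: "sign_mean 1 I (\<lambda>e. if t < \<phi> e then 1 else 0) e \<le> 1 / (4 * C)"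
  shows "sign_mean 1 I (\<lambda>e. \<phi> e ^ 2) e \<le> 2 * t\<^sup>2"
proof -
  define A where "A = sign_mean 1 I (\<lambda>e. \<phi> e ^ 2) e"
  have "0 \<le> A" unfolding A_def by (intro sign_mean_nonneg) simp
  show ?thesis
  proof (cases "A = 0")
    case False
    then have "0 < A" using \<open>0 \<le> A\<close> by simp
    \<comment> \<open>This value makes both error terms, \<open>l * (C * A\<^sup>2)\<close> and
      \<open>1 / (4 * l) * (1 / (4 * C))\<close>, equal to \<open>A / 4\<close>.\<close>
    define l where "l = 1 / (4 * C * A)"
    have "0 < l" using \<open>0 < A\<close> assms(2) by (simp add: l_def)
    have "\<phi> e ^ 2 \<le> (t\<^sup>2 + l * \<phi> e ^ 4) + (1 / (4 * l)) * (if t < \<phi> e then 1 else 0)" for e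
    proof (cases "t < \<phi> e")
      case True
      have "0 \<le> (2 * l * \<phi> e ^ 2 - 1)\<^sup>2" by simp
      also have "\<dots> = 4 * l * (l * \<phi> e ^ 4 + 1 / (4 * l) - \<phi> e ^ 2)"
        using \<open>0 < l\<close> by (simp add: power2_eq_square power4_eq_xxxx field_simps)
      finally have "0 \<le> l * \<phi> e ^ 4 + 1 / (4 * l) - \<phi> e ^ 2"
        using \<open>0 < l\<close> by (simp add: zero_le_mult_iff)
      then have "\<phi> e ^ 2 \<le> l * \<phi> e ^ 4 + 1 / (4 * l)" by simp
      then show ?thesis
        unfolding if_P[OF True] mult_1_right add.assoc by (rule add_increasing[OF zero_le_power2])
    next
      case False
      then have "\<phi> e ^ 2 \<le> t\<^sup>2" using nonneg by (intro power_mono) auto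
      then show ?thesis using False \<open>0 < l\<close> nonneg by (simp add: add_increasing2)
    qed
    then have "A \<le> sign_mean 1 I (\<lambda>e. (t\<^sup>2 + l * \<phi> e ^ 4) + (1 / (4 * l)) * (if t < \<phi> e then 1 else 0)) e"
      unfolding A_def by (rule sign_mean_mono)
    also have "\<dots> = (t\<^sup>2 + l * sign_mean 1 I (\<lambda>e. \<phi> e ^ 4) e)
        + (1 / (4 * l)) * sign_mean 1 I (\<lambda>e. if t < \<phi> e then 1 else 0) e"
      by (simp only: sign_mean_add sign_mean_cmult sign_mean_const)
    also have "\<dots> \<le> (t\<^sup>2 + l * (C * A\<^sup>2)) + (1 / (4 * l)) * (1 / (4 * C))"
      using fourth small \<open>0 < l\<close> unfolding A_def by (intro add_mono mult_left_mono) auto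
    also have "\<dots> = t\<^sup>2 + A / 2"
      using \<open>0 < A\<close> assms(2) by (simp add: l_def power2_eq_square field_simps)
    finally show ?thesis by (simp add: A_def)
  qed (simp add: A_def)
qed

text \<open>At the finitely many points that an average tests, finitely many functionals suffice to
  approximate the norm.\<close>

lemma sign_mean_mono_finite_support:
  "\<exists>P. finite P \<and> (\<forall>g h. (\<forall>e'\<in>P. g e' \<le> h e') \<longrightarrow> sign_mean \<rho> I g e \<le> sign_mean \<rho> I h e)"
proof (induction I arbitrary: e)
  case Nil
  show ?case by (intro exI[of _ "{e}"]) simp
next
  case (Cons i I)
  from Cons.IH[of "e(i := \<rho>)"] obtain P where
    P: "finite P" "\<forall>g h. (\<forall>e'\<in>P. g e' \<le> h e') \<longrightarrow> sign_mean \<rho> I g (e(i := \<rho>)) \<le> sign_mean \<rho> I h (e(i := \<rho>))"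
    by (elim exE conjE)
  from Cons.IH[of "e(i := - \<rho>)"] obtain Q where
    Q: "finite Q" "\<forall>g h. (\<forall>e'\<in>Q. g e' \<le> h e') \<longrightarrow> sign_mean \<rho> I g (e(i := - \<rho>)) \<le> sign_mean \<rho> I h (e(i := - \<rho>))"
    by (elim exE conjE)
  show ?case
  proof (intro exI[of _ "P \<union> Q"] conjI allI impI)
    fix g h :: "(nat \<Rightarrow> real) \<Rightarrow> real" assume le: "\<forall>e'\<in>P \<union> Q. g e' \<le> h e'"
    show "sign_mean \<rho> (i # I) g e \<le> sign_mean \<rho> (i # I) h e"
      unfolding sign_mean.simps using le by (intro divide_right_mono add_mono P(2)[rule_format] Q(2)[rule_format]) auto
  qed (use P(1) Q(1) in auto)
qed

section \<open>The norm seen through the norming set\<close>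

lemma norming_set_abs_le:
  assumes "norming_set D" "f \<in> D"
  shows "\<bar>blinfun_apply f x\<bar> \<le> norm x"
proof -
  have "norm f \<le> 1" using assms by (auto simp: norming_set_def)
  then have "norm f * norm x \<le> 1 * norm x" by (intro mult_right_mono) auto
  then show ?thesis using norm_blinfun[of f x] by simp
qed

lemma norming_set_least:
  assumes "norming_set D" "D \<noteq> {}" "\<And>f. f \<in> D \<Longrightarrow> \<bar>blinfun_apply f x\<bar> \<le> c"
  shows "norm x \<le> c"
  using assms cSUP_least[of D "\<lambda>f. \<bar>blinfun_apply f x\<bar>" c] by (simp add: norming_set_def)

text \<open>Whatever value the supremum of the empty set has, it is the norm of every vector, in
  particular of zero.\<close>

lemma norming_set_empty_norm:
  fixes D :: "('b::banach \<Rightarrow>\<^sub>L real) set"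
  assumes "norming_set D" "D = {}"
  shows "norm (x :: 'b) = 0"
proof -
  have "norm y = Sup {}" for y :: 'b using assms by (simp add: norming_set_def)
  from this[of x] this[of 0] show ?thesis by simp
qed

lemma coord_convex_Max:
  assumes "finite F" "F \<noteq> {}" "\<And>f. f \<in> F \<Longrightarrow> coord_convex (\<phi> f)"
  shows "coord_convex (\<lambda>e. Max ((\<lambda>f. \<phi> f e) ` F))"
  unfolding coord_convex_def
proof (intro conjI allI impI)
  have upper: "\<phi> f e \<le> Max ((\<lambda>f. \<phi> f e) ` F)" if "f \<in> F" for f e
    using assms that by (intro Max_ge) auto
  fix e :: "nat \<Rightarrow> real"
  obtain f where "f \<in> F" using assms(2) by auto
  then show "0 \<le> Max ((\<lambda>f. \<phi> f e) ` F)"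
    using upper coord_convex_nonneg assms(3) order_trans by blast
  fix i and u :: real assume u: "\<bar>u\<bar> \<le> 1"
  have "\<phi> f (e(i := u)) \<le> (1 + u) / 2 * Max ((\<lambda>f. \<phi> f (e(i := 1))) ` F)
      + (1 - u) / 2 * Max ((\<lambda>f. \<phi> f (e(i := - 1))) ` F)" if "f \<in> F" for f
  proof -
    have "\<phi> f (e(i := u)) \<le> (1 + u) / 2 * \<phi> f (e(i := 1)) + (1 - u) / 2 * \<phi> f (e(i := - 1))"
      using assms(3)[OF that] u by (rule coord_convexD)
    also have "\<dots> \<le> (1 + u) / 2 * Max ((\<lambda>f. \<phi> f (e(i := 1))) ` F)
      + (1 - u) / 2 * Max ((\<lambda>f. \<phi> f (e(i := - 1))) ` F)"
      using u upper[OF that] by (intro add_mono mult_left_mono) auto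
    finally show ?thesis .
  qed
  then show "Max ((\<lambda>f. \<phi> f (e(i := u))) ` F) \<le> (1 + u) / 2 * Max ((\<lambda>f. \<phi> f (e(i := 1))) ` F)
      + (1 - u) / 2 * Max ((\<lambda>f. \<phi> f (e(i := - 1))) ` F)"
    using assms by (subst Max_le_iff) auto
qed

lemma multi_affine_blinfun:
  assumes "multi_affine F"
  shows "multi_affine (\<lambda>e. blinfun_apply f (F e))"
  unfolding multi_affine_def
proof (intro allI)
  fix e i u
  show "blinfun_apply f (F (e(i := u))) = blinfun_apply f (F (e(i := 0)))
      + u *\<^sub>R (blinfun_apply f (F (e(i := 1))) - blinfun_apply f (F (e(i := 0))))"
    unfolding multi_affineD[OF assms, of e i u] partial_diff_def
    by (simp only: blinfun.add_right blinfun.diff_right blinfun.scaleR_right)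
qed

lemma borel_measurable_chaos_partial_sum:
  assumes "\<And>i. \<epsilon> i \<in> borel_measurable N"
  shows "chaos_partial_sum d a \<epsilon> n \<in> borel_measurable N"
proof -
  have "(\<lambda>\<omega>. \<Prod>i\<leftarrow>is. \<epsilon> i \<omega>) \<in> borel_measurable N" for "is"
  proof (induction "is")
    case (Cons i js)
    then show ?case using borel_measurable_times[OF assms[of i] Cons] by simp
  qed simp
  then show ?thesis unfolding chaos_partial_sum_def[abs_def]
    by (intro borel_measurable_sum borel_measurable_times borel_measurable_const)
qed

lemma borel_measurable_chaos_sum:
  assumes "\<And>i. \<epsilon> i \<in> borel_measurable N"
  shows "chaos_sum d a \<epsilon> \<in> borel_measurable N"
  unfolding chaos_sum_def[abs_def]
  by (intro borel_measurable_lim_metric borel_measurable_chaos_partial_sum assms)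

lemma rademacher_measurable: "rademacher_sequence N \<epsilon> \<Longrightarrow> \<epsilon> i \<in> borel_measurable N"
  unfolding rademacher_sequence_def by (auto simp: prob_space.indep_vars_def2)

text \<open>Almost surely, exceeding \<open>t'\<close> for infinitely many \<open>m\<close> can
  happen only in \<open>U\<close>; the slack between \<open>t\<close> and \<open>t'\<close> and the
  finiteness of \<open>F\<close> ensure this. The events of some exceedance from \<open>k\<close> on
  decrease to that limit event, so continuity of the measure applies.\<close>

lemma eventually_prob_small:
  fixes f :: "'f \<Rightarrow> nat \<Rightarrow> 'c \<Rightarrow> real"
  assumes "prob_space N" "finite F"
    and meas: "\<And>f' m. f' \<in> F \<Longrightarrow> f f' m \<in> borel_measurable N"
    and lim: "\<And>f'. f' \<in> F \<Longrightarrow> AE \<omega> in N. (\<lambda>m. f f' m \<omega>) \<longlonglongrightarrow> l f' \<omega>"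
    and U: "U \<in> sets N" "measure N U < \<theta>" "\<And>\<omega> f'. \<omega> \<in> space N - U \<Longrightarrow> f' \<in> F \<Longrightarrow> \<bar>l f' \<omega>\<bar> \<le> t"
    and "t < t'"
  shows "\<exists>m\<ge>n. measure N {\<omega> \<in> space N. \<exists>f'\<in>F. t' < \<bar>f f' m \<omega>\<bar>} < \<theta>"
proof -
  interpret prob_space N by (rule assms(1))
  define B where "B m = {\<omega> \<in> space N. \<exists>f'\<in>F. t' < \<bar>f f' m \<omega>\<bar>}" for m
  define H where "H k = (\<Union>m\<in>{k..}. B m)" for k
  have B: "B m \<in> sets N" for m
  proof -
    have "B m = (\<Union>f'\<in>F. {\<omega> \<in> space N. t' < \<bar>f f' m \<omega>\<bar>})" by (auto simp: B_def)
    also have "\<dots> \<in> sets N"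
      using assms(2) meas by (intro sets.finite_UN borel_measurable_less borel_measurable_abs) auto
    finally show ?thesis .
  qed
  then have H: "H k \<in> sets N" for k unfolding H_def by (intro sets.countable_UN') auto
  have "AE \<omega> in N. \<omega> \<in> (\<Inter>k. H k) \<longrightarrow> \<omega> \<in> U"
  proof -
    have "AE \<omega> in N. \<forall>f'\<in>F. (\<lambda>m. f f' m \<omega>) \<longlonglongrightarrow> l f' \<omega>"
      using assms(2) lim by (simp add: AE_finite_all)
    with AE_space show ?thesis
    proof eventually_elim
      case (elim \<omega>)
      show ?case
      proof (rule impI, rule ccontr)
        assume inH: "\<omega> \<in> (\<Inter>k. H k)" and notU: "\<omega> \<notin> U"
        have "\<forall>\<^sub>F m in sequentially. \<forall>f'\<in>F. \<bar>f f' m \<omega>\<bar> < t'"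
        proof (intro eventually_ball_finite assms(2) ballI)
          fix f' assume "f' \<in> F"
          then have "(\<lambda>m. \<bar>f f' m \<omega>\<bar>) \<longlonglongrightarrow> \<bar>l f' \<omega>\<bar>" "\<bar>l f' \<omega>\<bar> < t'"
            using elim U(3)[of \<omega> f'] notU assms(8) by (auto intro!: tendsto_rabs)
          then show "\<forall>\<^sub>F m in sequentially. \<bar>f f' m \<omega>\<bar> < t'" by (rule order_tendstoD(2))
        qed
        then obtain k where "\<And>m f'. k \<le> m \<Longrightarrow> f' \<in> F \<Longrightarrow> \<bar>f f' m \<omega>\<bar> < t'"
          by (auto simp: eventually_sequentially)
        moreover obtain m where "k \<le> m" "\<omega> \<in> B m" using inH by (auto simp: H_def)
        ultimately show False by (force simp: B_def)
      qed
    qed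
  qed
  then have "measure N (\<Inter>k. H k) \<le> measure N U"
    using U(1) H by (intro finite_measure_mono_AE) auto
  moreover have "(\<lambda>k. measure N (H k)) \<longlonglongrightarrow> measure N (\<Inter>k. H k)"
  proof (rule finite_Lim_measure_decseq)
    show "decseq H" unfolding decseq_def H_def by (intro allI impI UN_mono) auto
  qed (use H in auto)
  ultimately have "\<forall>\<^sub>F k in sequentially. measure N (H k) < \<theta>"
    using U(2) by (auto intro: order_tendstoD(2)[where y = "measure N (\<Inter>k. H k)"])
  then obtain m where "n \<le> m" "measure N (H m) < \<theta>"
    by (auto simp: eventually_sequentially) (metis linorder_le_cases)
  moreover have "measure N (B m) \<le> measure N (H m)"
    using H by (intro finite_measure_mono) (auto simp: H_def)
  ultimately show ?thesis unfolding B_def[symmetric] by force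
qed

lemma norming_set_power_le_SUP:
  assumes "norming_set D" "D \<noteq> {}" "0 < p"
  shows "ennreal (norm x ^ p) \<le> (SUP f\<in>D. ennreal (\<bar>blinfun_apply f x\<bar> ^ p))"
proof -
  define c where "c = (SUP f\<in>D. ennreal (\<bar>blinfun_apply f x\<bar> ^ p))"
  have "c \<le> ennreal (norm x ^ p)"
    unfolding c_def using norming_set_abs_le[OF assms(1)]
    by (intro SUP_least ennreal_leI power_mono) auto
  then obtain r where r: "c = ennreal r" "0 \<le> r" by (cases c) (auto simp: top_unique)
  have "\<bar>blinfun_apply f x\<bar> \<le> root p r" if "f \<in> D" for f
  proof -
    have "ennreal (\<bar>blinfun_apply f x\<bar> ^ p) \<le> ennreal r"
      unfolding r(1)[symmetric] c_def using that by (rule SUP_upper)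
    then have "\<bar>blinfun_apply f x\<bar> ^ p \<le> r" using r(2) by simp
    then have "root p (\<bar>blinfun_apply f x\<bar> ^ p) \<le> root p r" using assms(3) by simp
    then show ?thesis using assms(3) by (simp add: real_root_power_cancel)
  qed
  then have "norm x \<le> root p r" using assms(1,2) by (intro norming_set_least) auto
  then have "norm x ^ p \<le> root p r ^ p" by (intro power_mono) auto
  then show ?thesis using assms(3) r by (simp add: c_def[symmetric] ennreal_leI)
qed

text \<open>The two probability spaces communicate only through measurable functions of the
  coordinates indexed by \<open>D\<close>; every later transfer is an instance of this.\<close>

lemma chaos_law:
  assumes "rademacher_sequence N \<epsilon>" "random_variable_via D M X"
    and law: "distr N (PiM D (\<lambda>_. borel)) (\<lambda>\<omega>. \<lambda>f\<in>D. chaos_sum d (\<lambda>is. blinfun_apply f (x is)) \<epsilon> \<omega>)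
      = distr M (PiM D (\<lambda>_. borel)) (\<lambda>\<omega>. \<lambda>f\<in>D. blinfun_apply f (X \<omega>))"
    and H: "H \<in> borel_measurable (PiM D (\<lambda>_. borel))"
  shows "(\<integral>\<^sup>+ \<omega>. H (\<lambda>f\<in>D. blinfun_apply f (X \<omega>)) \<partial>M)
    = (\<integral>\<^sup>+ \<omega>. H (\<lambda>f\<in>D. chaos_sum d (\<lambda>is. blinfun_apply f (x is)) \<epsilon> \<omega>) \<partial>N)"
proof -
  have X: "(\<lambda>\<omega>. \<lambda>f\<in>D. blinfun_apply f (X \<omega>)) \<in> measurable M (PiM D (\<lambda>_. borel))"
    using assms(2) by (intro measurable_restrict) (auto simp: random_variable_via_def)
  have S: "(\<lambda>\<omega>. \<lambda>f\<in>D. chaos_sum d (\<lambda>is. blinfun_apply f (x is)) \<epsilon> \<omega>) \<in> measurable N (PiM D (\<lambda>_. borel))"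
    by (intro measurable_restrict borel_measurable_chaos_sum rademacher_measurable[OF assms(1)])
  have H': "H \<in> borel_measurable (distr Q (PiM D (\<lambda>_. borel)) T)" for Q :: "'q measure" and T
    using H by simp
  show ?thesis
    unfolding nn_integral_distr[OF X H', symmetric] nn_integral_distr[OF S H', symmetric] law ..
qed

lemma chaos_second_moment_bounded:
  fixes D :: "('b::banach \<Rightarrow>\<^sub>L real) set"
  assumes "countable D" "norming_set D" and rad: "rademacher_sequence N \<epsilon>" and "prob_space M"
    and X: "random_variable_via D M X" and x: "symmetric_tetrahedral d x"
    and conv: "\<And>f. f \<in> D \<Longrightarrow> AE \<omega> in N. convergent (\<lambda>n. chaos_partial_sum d (\<lambda>is. blinfun_apply f (x is)) \<epsilon> n \<omega>)"
    and law: "distr N (PiM D (\<lambda>_. borel)) (\<lambda>\<omega>. \<lambda>f\<in>D. chaos_sum d (\<lambda>is. blinfun_apply f (x is)) \<epsilon> \<omega>)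
      = distr M (PiM D (\<lambda>_. borel)) (\<lambda>\<omega>. \<lambda>f\<in>D. blinfun_apply f (X \<omega>))"
  shows "\<exists>V>0. \<forall>m. chaos_moment d x 2 m \<le> V\<^sup>2"
proof (cases "D = {}")
  case True
  have "chaos_moment d x 2 m \<le> 1\<^sup>2" for m
    unfolding chaos_moment_def norming_set_empty_norm[OF assms(2) True] by simp
  then show ?thesis by (intro exI[of _ 1]) auto
next
  case False
  interpret M: prob_space M by (rule assms(4))
  have N: "prob_space N" using rad by (simp add: rademacher_sequence_def)
  interpret N: prob_space N by (rule N)
  let ?S = "\<lambda>f. chaos_sum d (\<lambda>is. blinfun_apply f (x is)) \<epsilon>"
  let ?P = "\<lambda>f. chaos_partial_sum d (\<lambda>is. blinfun_apply f (x is)) \<epsilon>"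
  note Pmeas = borel_measurable_chaos_partial_sum[OF rademacher_measurable[OF rad], of d]
  note Smeas = borel_measurable_chaos_sum[OF rademacher_measurable[OF rad], of d]
  \<comment> \<open>The hypercontractive constant from exponent 2 to exponent 4,
    \<open>4 ^ (2 * d)\<close>.\<close>
  define C :: real where "C = 16 ^ d"
  have "0 < C" by (simp add: C_def)
  have Ux: "{\<omega> \<in> space M. \<exists>f\<in>D. t < \<bar>blinfun_apply f (X \<omega>)\<bar>} \<in> sets M" for t
  proof -
    have "{\<omega> \<in> space M. \<exists>f\<in>D. t < \<bar>blinfun_apply f (X \<omega>)\<bar>} = (\<Union>f\<in>D. {\<omega> \<in> space M. t < \<bar>blinfun_apply f (X \<omega>)\<bar>})"
      by auto
    also have "\<dots> \<in> sets M"
      using X assms(1) unfolding random_variable_via_def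
      by (intro sets.countable_UN' borel_measurable_less borel_measurable_abs) auto
    finally show ?thesis .
  qed
  have Us: "{\<omega> \<in> space N. \<exists>f\<in>D. t < \<bar>?S f \<omega>\<bar>} \<in> sets N" for t
  proof -
    have "{\<omega> \<in> space N. \<exists>f\<in>D. t < \<bar>?S f \<omega>\<bar>} = (\<Union>f\<in>D. {\<omega> \<in> space N. t < \<bar>?S f \<omega>\<bar>})"
      by auto
    also have "\<dots> \<in> sets N"
      using Smeas assms(1)
      by (intro sets.countable_UN' borel_measurable_less borel_measurable_abs) auto
    finally show ?thesis .
  qed
  have prob_eq: "measure M {\<omega> \<in> space M. \<exists>f\<in>D. t < \<bar>blinfun_apply f (X \<omega>)\<bar>}
      = measure N {\<omega> \<in> space N. \<exists>f\<in>D. t < \<bar>?S f \<omega>\<bar>}" for t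
  proof -
    define H :: "(('b \<Rightarrow>\<^sub>L real) \<Rightarrow> real) \<Rightarrow> ennreal"
      where "H = indicator {y \<in> space (PiM D (\<lambda>_. borel)). \<exists>f\<in>D. t < \<bar>y f\<bar>}"
    have "{y \<in> space (PiM D (\<lambda>_. borel)). \<exists>f\<in>D. t < \<bar>y f\<bar>}
        = (\<Union>f\<in>D. {y \<in> space (PiM D (\<lambda>_. borel)). t < \<bar>(y f :: real)\<bar>})" by auto
    also have "\<dots> \<in> sets (PiM D (\<lambda>_. borel))"
      using assms(1) by (intro sets.countable_UN' borel_measurable_less borel_measurable_abs) auto
    finally have "H \<in> borel_measurable (PiM D (\<lambda>_. borel))"
      unfolding H_def by (rule borel_measurable_indicator)
    from chaos_law[OF rad X law this]
    have "(\<integral>\<^sup>+ \<omega>. indicator {\<omega> \<in> space M. \<exists>f\<in>D. t < \<bar>blinfun_apply f (X \<omega>)\<bar>} \<omega> \<partial>M)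
      = (\<integral>\<^sup>+ \<omega>. indicator {\<omega> \<in> space N. \<exists>f\<in>D. t < \<bar>?S f \<omega>\<bar>} \<omega> \<partial>N)"
      by (simp add: H_def space_PiM PiE_def indicator_def cong: nn_integral_cong_simp)
    then show ?thesis
      using Ux[of t] Us[of t] by (simp add: M.emeasure_eq_measure N.emeasure_eq_measure)
  qed
  \<comment> \<open>Tightness comes from the side of \<open>X\<close>: its values have finite norm,
    so these events decrease to the empty set.\<close>
  have "(\<lambda>k. measure M {\<omega> \<in> space M. \<exists>f\<in>D. real k < \<bar>blinfun_apply f (X \<omega>)\<bar>})
      \<longlonglongrightarrow> measure M (\<Inter>k. {\<omega> \<in> space M. \<exists>f\<in>D. real k < \<bar>blinfun_apply f (X \<omega>)\<bar>})"
  proof (rule M.finite_Lim_measure_decseq)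
    show "decseq (\<lambda>k. {\<omega> \<in> space M. \<exists>f\<in>D. real k < \<bar>blinfun_apply f (X \<omega>)\<bar>})"
      by (rule decseq_SucI) force
  qed (use Ux in auto)
  also have "(\<Inter>k. {\<omega> \<in> space M. \<exists>f\<in>D. real k < \<bar>blinfun_apply f (X \<omega>)\<bar>}) = {}"
  proof (rule ccontr)
    assume "\<not> ?thesis"
    then obtain \<omega> where \<omega>: "\<And>k. \<exists>f\<in>D. real k < \<bar>blinfun_apply f (X \<omega>)\<bar>" by auto
    obtain k where "norm (X \<omega>) \<le> real k" using real_arch_simple by blast
    with \<omega>[of k] norming_set_abs_le[OF assms(2), of _ "X \<omega>"] show False by fastforce
  qed
  finally have "\<forall>\<^sub>F k in sequentially. measure M {\<omega> \<in> space M. \<exists>f\<in>D. real k < \<bar>blinfun_apply f (X \<omega>)\<bar>} < 1 / (4 * C)"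
    using \<open>0 < C\<close> by (intro order_tendstoD(2)[where y = 0]) auto
  then obtain k where k: "measure N {\<omega> \<in> space N. \<exists>f\<in>D. real k < \<bar>?S f \<omega>\<bar>} < 1 / (4 * C)"
    unfolding prob_eq by (auto simp: eventually_sequentially)
  define t where "t = real k + 1"
  \<comment> \<open>Convergence is given for one functional at a time, hence the restriction to
    finite \<open>F\<close>. The bound depends neither on \<open>F\<close> nor on \<open>n\<close>,
    which permits choosing \<open>F\<close> after \<open>n\<close> below.\<close>
  have finite_bound: "sign_mean 1 [0..<n] (\<lambda>e. Max ((\<lambda>f. \<bar>blinfun_apply f (chaos_poly d x n e)\<bar>) ` F) ^ 2) (\<lambda>_. 0) \<le> 2 * t\<^sup>2"
    if F: "finite F" "F \<noteq> {}" "F \<subseteq> D" for F n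
  proof -
    define \<phi> where "\<phi> m e = Max ((\<lambda>f. \<bar>blinfun_apply f (chaos_poly d x m e)\<bar>) ` F)" for m e
    have "coord_convex (\<lambda>e. \<bar>blinfun_apply f (chaos_poly d x m e)\<bar>)" for f :: "'b \<Rightarrow>\<^sub>L real" and m
      using coord_convex_norm[OF multi_affine_blinfun[OF multi_affine_chaos_poly[OF x]], of f m] by simp
    then have \<phi>: "coord_convex (\<phi> m)" for m
      unfolding \<phi>_def[abs_def] using F by (intro coord_convex_Max) auto
    have lim: "AE \<omega> in N. (\<lambda>m. ?P f m \<omega>) \<longlonglongrightarrow> ?S f \<omega>" if "f \<in> F" for f
    proof -
      have "AE \<omega> in N. convergent (\<lambda>m. ?P f m \<omega>)" using conv F that by blast
      then show ?thesis by eventually_elim (simp only: chaos_sum_def convergent_LIMSEQ_iff)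
    qed
    have bound: "\<bar>?S f \<omega>\<bar> \<le> real k"
      if "\<omega> \<in> space N - {\<omega> \<in> space N. \<exists>f\<in>D. real k < \<bar>?S f \<omega>\<bar>}" "f \<in> F" for \<omega> f
      using that F(3) by (blast intro: leI)
    \<comment> \<open>One good \<open>m\<close> beyond \<open>n\<close> is enough, because the
      second moments increase with the length of the partial sum.\<close>
    have "\<exists>m\<ge>n. measure N {\<omega> \<in> space N. \<exists>f\<in>F. t < \<bar>?P f m \<omega>\<bar>} < 1 / (4 * C)"
      by (rule eventually_prob_small[OF N F(1) Pmeas lim Us k bound]) (simp_all only: t_def less_add_one)
    then obtain m where m: "n \<le> m" "measure N {\<omega> \<in> space N. \<exists>f\<in>F. t < \<bar>?P f m \<omega>\<bar>} < 1 / (4 * C)"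
      by blast
    have \<phi>_gt: "t < \<phi> m (\<lambda>i. \<epsilon> i \<omega>) \<longleftrightarrow> (\<exists>f\<in>F. t < \<bar>?P f m \<omega>\<bar>)" for \<omega>
      unfolding \<phi>_def blinfun_chaos_poly using F by (subst Max_gr_iff) auto
    have sets: "{\<omega> \<in> space N. \<exists>f\<in>F. t < \<bar>?P f m \<omega>\<bar>} \<in> sets N"
    proof -
      have "{\<omega> \<in> space N. \<exists>f\<in>F. t < \<bar>?P f m \<omega>\<bar>} = (\<Union>f\<in>F. {\<omega> \<in> space N. t < \<bar>?P f m \<omega>\<bar>})" by auto
      also have "\<dots> \<in> sets N"
        using F Pmeas by (intro sets.finite_UN borel_measurable_less borel_measurable_abs) auto
      finally show ?thesis .
    qed
    have "ennreal (sign_mean 1 [0..<m] (\<lambda>e. if t < \<phi> m e then 1 else 0) (\<lambda>_. 0))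
        = (\<integral>\<^sup>+ \<omega>. ennreal (if t < \<phi> m (\<lambda>i. \<epsilon> i \<omega>) then 1 else 0) \<partial>N)"
    proof (rule nn_integral_rademacher[OF rad, symmetric])
      fix e e' :: "nat \<Rightarrow> real" assume "\<And>j. j < m \<Longrightarrow> e j = e' j"
      then have "chaos_poly d x m e = chaos_poly d x m e'" by (rule chaos_poly_cong)
      then show "(if t < \<phi> m e then 1 else 0 :: real) = (if t < \<phi> m e' then 1 else 0)" by (simp add: \<phi>_def)
    qed simp
    also have "\<dots> = (\<integral>\<^sup>+ \<omega>. indicator {\<omega> \<in> space N. \<exists>f\<in>F. t < \<bar>?P f m \<omega>\<bar>} \<omega> \<partial>N)"
      unfolding \<phi>_gt by (intro nn_integral_cong) (simp add: indicator_def)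
    also have "\<dots> = ennreal (measure N {\<omega> \<in> space N. \<exists>f\<in>F. t < \<bar>?P f m \<omega>\<bar>})"
      using sets by (simp add: N.emeasure_eq_measure)
    finally have small: "sign_mean 1 [0..<m] (\<lambda>e. if t < \<phi> m e then 1 else 0) (\<lambda>_. 0) \<le> 1 / (4 * C)"
      using m(2) by (subst (asm) ennreal_inj) (auto intro!: sign_mean_nonneg)
    have hom: "\<phi> m (\<lambda>j. c * e j) = c ^ d * \<phi> m e" if "0 < c" for c e
    proof -
      have "Max ((\<lambda>f. c ^ d * \<bar>blinfun_apply f (chaos_poly d x m e)\<bar>) ` F)
          = c ^ d * Max ((\<lambda>f. \<bar>blinfun_apply f (chaos_poly d x m e)\<bar>) ` F)"
        using that F mono_Max_commute[of "\<lambda>y. c ^ d * y" "(\<lambda>f. \<bar>blinfun_apply f (chaos_poly d x m e)\<bar>) ` F"]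
        by (simp add: image_image mono_def mult_left_mono)
      then show ?thesis using that
        by (simp add: \<phi>_def chaos_poly_scale blinfun.scaleR_right abs_mult)
    qed
    have "sign_mean 1 [0..<m] (\<lambda>e. \<phi> m e ^ (2 * 1 * 2)) (\<lambda>_. 0)
        \<le> real (2 * 2) ^ (1 * 2 * d) * (sign_mean 1 [0..<m] (\<lambda>e. \<phi> m e ^ (2 * 1)) (\<lambda>_. 0))\<^sup>2"
      using hom by (intro hypercontractivity_homogeneous \<phi>) auto
    then have "sign_mean 1 [0..<m] (\<lambda>e. \<phi> m e ^ 4) (\<lambda>_. 0)
        \<le> C * (sign_mean 1 [0..<m] (\<lambda>e. \<phi> m e ^ 2) (\<lambda>_. 0))\<^sup>2"
      by (simp add: C_def power_mult)
    then have *: "sign_mean 1 [0..<m] (\<lambda>e. \<phi> m e ^ 2) (\<lambda>_. 0) \<le> 2 * t\<^sup>2"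
      using \<phi> \<open>0 < C\<close> small by (intro second_moment_le_of_fourth) (auto intro: coord_convex_nonneg)
    have "sign_mean 1 [0..<n] (\<lambda>e. \<phi> n e ^ 2) (\<lambda>_. 0) = sign_mean 1 [0..<n] (\<lambda>e. \<phi> m e ^ 2) (\<lambda>_. 0)"
    proof (rule sign_mean_cong_on)
      fix e :: "nat \<Rightarrow> real" assume "\<And>j. j \<notin> set [0..<n] \<Longrightarrow> e j = 0"
      then have "chaos_poly d x m e = chaos_poly d x n e"
        using m(1) by (intro chaos_poly_extend) auto
      then show "\<phi> n e ^ 2 = \<phi> m e ^ 2" by (simp add: \<phi>_def)
    qed
    also have "\<dots> \<le> sign_mean 1 [0..<m] (\<lambda>e. \<phi> m e ^ 2) (\<lambda>_. 0)"
      by (intro sign_mean_upt_mono coord_convex_power \<phi> m(1))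
    finally show ?thesis using * by (simp add: \<phi>_def)
  qed
  have "chaos_moment d x 2 n \<le> (3 * t)\<^sup>2" for n
  proof -
    obtain P where P: "finite P" "\<And>g h. (\<forall>e\<in>P. g e \<le> h e) \<Longrightarrow> sign_mean 1 [0..<n] g (\<lambda>_. 0) \<le> sign_mean 1 [0..<n] h (\<lambda>_. 0)"
      using sign_mean_mono_finite_support[of 1 "[0..<n]" "\<lambda>_. 0"] by (elim exE conjE) (rule that, auto)
    \<comment> \<open>The supremum need not be attained, so half of the norm is taken; this costs
      the factor 4 in the second moment.\<close>
    have "\<exists>f\<in>D. norm y \<le> 2 * \<bar>blinfun_apply f y\<bar>" for y :: 'b
    proof (rule ccontr)
      assume "\<not> ?thesis"
      then have less: "\<bar>blinfun_apply f y\<bar> \<le> norm y / 2" "2 * \<bar>blinfun_apply f y\<bar> < norm y" if "f \<in> D" for f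
        using that by force+
      have "norm y \<le> norm y / 2" using less(1) False by (intro norming_set_least[OF assms(2)])
      moreover obtain f where "f \<in> D" using False by auto
      ultimately show False using less(2)[of f] by simp
    qed
    then obtain f where f: "\<And>y. f y \<in> D" "\<And>y. norm y \<le> 2 * \<bar>blinfun_apply (f y) y\<bar>" for y :: 'b by metis
    obtain f0 where "f0 \<in> D" using False by auto
    \<comment> \<open>Including \<open>f0\<close> guarantees that \<open>Max\<close> is taken over a
      nonempty set.\<close>
    define F where "F = insert f0 ((\<lambda>e. f (chaos_poly d x n e)) ` P)"
    have F: "finite F" "F \<noteq> {}" "F \<subseteq> D" using P(1) f \<open>f0 \<in> D\<close> by (auto simp: F_def)
    let ?\<phi> = "\<lambda>e. Max ((\<lambda>f. \<bar>blinfun_apply f (chaos_poly d x n e)\<bar>) ` F)"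
    have "chaos_moment d x 2 n \<le> sign_mean 1 [0..<n] (\<lambda>e. 4 * ?\<phi> e ^ 2) (\<lambda>_. 0)"
      unfolding chaos_moment_def
    proof (rule P(2), rule ballI)
      fix e assume "e \<in> P"
      let ?y = "chaos_poly d x n e"
      have "\<bar>blinfun_apply (f ?y) ?y\<bar> \<le> ?\<phi> e"
        using F(1) \<open>e \<in> P\<close> by (intro Max_ge) (auto simp: F_def)
      then have "norm ?y \<le> 2 * ?\<phi> e" using f(2)[of ?y] by linarith
      then have "norm ?y ^ 2 \<le> (2 * ?\<phi> e) ^ 2" by (intro power_mono) auto
      then show "norm ?y ^ 2 \<le> 4 * ?\<phi> e ^ 2" by (simp add: power_mult_distrib)
    qed
    also have "\<dots> \<le> 4 * (2 * t\<^sup>2)"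
      unfolding sign_mean_cmult using finite_bound[OF F] by (intro mult_left_mono) auto
    also have "\<dots> \<le> (3 * t)\<^sup>2" by (simp add: power_mult_distrib)
    finally show ?thesis .
  qed
  then show ?thesis by (intro exI[of _ "3 * t"]) (auto simp: t_def)
qed

section \<open>Exponential integrability\<close>

lemma borel_measurable_norm_via:
  assumes "countable D" "norming_set D" "random_variable_via D M X"
  shows "(\<lambda>\<omega>. norm (X \<omega>)) \<in> borel_measurable M"
proof -
  have "(\<lambda>\<omega>. norm (X \<omega>)) = (\<lambda>\<omega>. SUP f\<in>D. \<bar>blinfun_apply f (X \<omega>)\<bar>)"
    using assms(2) unfolding norming_set_def by blast
  also have "\<dots> \<in> borel_measurable M"
  proof (rule borel_measurable_cSUP[OF assms(1)])
    show "(\<lambda>\<omega>. \<bar>blinfun_apply f (X \<omega>)\<bar>) \<in> borel_measurable M" if "f \<in> D" for f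
      using assms(3) that by (auto simp: random_variable_via_def)
    show "bdd_above ((\<lambda>f. \<bar>blinfun_apply f (X \<omega>)\<bar>) ` D)" for \<omega>
      by (rule bdd_aboveI2) (rule norming_set_abs_le[OF assms(2)])
  qed
  finally show ?thesis .
qed

text \<open>Countability of \<open>D\<close> gives almost sure convergence for all functionals at
  once; each limit is then below the lower limit of the norms, and Fatou applies.\<close>

lemma chaos_moment_fatou:
  fixes D :: "('b::banach \<Rightarrow>\<^sub>L real) set"
  assumes "countable D" "norming_set D" "D \<noteq> {}" and rad: "rademacher_sequence N \<epsilon>"
    and X: "random_variable_via D M X"
    and conv: "\<And>f. f \<in> D \<Longrightarrow> AE \<omega> in N. convergent (\<lambda>n. chaos_partial_sum d (\<lambda>is. blinfun_apply f (x is)) \<epsilon> n \<omega>)"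
    and law: "distr N (PiM D (\<lambda>_. borel)) (\<lambda>\<omega>. \<lambda>f\<in>D. chaos_sum d (\<lambda>is. blinfun_apply f (x is)) \<epsilon> \<omega>)
      = distr M (PiM D (\<lambda>_. borel)) (\<lambda>\<omega>. \<lambda>f\<in>D. blinfun_apply f (X \<omega>))"
    and "0 < p" and bound: "\<And>m. n \<le> m \<Longrightarrow> chaos_moment d x p m \<le> B"
  shows "(\<integral>\<^sup>+ \<omega>. ennreal (norm (X \<omega>) ^ p) \<partial>M) \<le> ennreal B"
proof -
  let ?S = "\<lambda>f. chaos_sum d (\<lambda>is. blinfun_apply f (x is)) \<epsilon>"
  let ?P = "\<lambda>f. chaos_partial_sum d (\<lambda>is. blinfun_apply f (x is)) \<epsilon>"
  let ?Q = "\<lambda>m \<omega>. chaos_poly d x m (\<lambda>i. \<epsilon> i \<omega>)"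
  define H :: "(('b \<Rightarrow>\<^sub>L real) \<Rightarrow> real) \<Rightarrow> ennreal" where "H y = (SUP f\<in>D. ennreal (\<bar>y f\<bar> ^ p))" for y
  have H: "H \<in> borel_measurable (PiM D (\<lambda>_. borel))"
    unfolding H_def[abs_def] using assms(1) by (intro borel_measurable_SUP) auto
  have H_restrict: "H (\<lambda>f\<in>D. y f) = (SUP f\<in>D. ennreal (\<bar>y f\<bar> ^ p))" for y
    unfolding H_def by (intro SUP_cong) auto
  have norm_meas: "(\<lambda>\<omega>. norm (?Q m \<omega>)) \<in> borel_measurable N" for m
    using assms(1,2)
  proof (rule borel_measurable_norm_via)
    show "random_variable_via D N (?Q m)"
      unfolding random_variable_via_def blinfun_chaos_poly
      by (intro ballI borel_measurable_chaos_partial_sum rademacher_measurable[OF rad])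
  qed
  have "(\<integral>\<^sup>+ \<omega>. ennreal (norm (X \<omega>) ^ p) \<partial>M) \<le> (\<integral>\<^sup>+ \<omega>. H (\<lambda>f\<in>D. blinfun_apply f (X \<omega>)) \<partial>M)"
    unfolding H_restrict by (intro nn_integral_mono norming_set_power_le_SUP assms)
  also have "\<dots> = (\<integral>\<^sup>+ \<omega>. (SUP f\<in>D. ennreal (\<bar>?S f \<omega>\<bar> ^ p)) \<partial>N)"
    using chaos_law[OF rad X law H] unfolding H_restrict .
  also have "\<dots> \<le> (\<integral>\<^sup>+ \<omega>. liminf (\<lambda>m. ennreal (norm (?Q m \<omega>) ^ p)) \<partial>N)"
  proof (rule nn_integral_mono_AE)
    have "AE \<omega> in N. \<forall>f\<in>D. convergent (\<lambda>n. ?P f n \<omega>)"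
      using assms(1) conv by (simp add: AE_ball_countable)
    then show "AE \<omega> in N. (SUP f\<in>D. ennreal (\<bar>?S f \<omega>\<bar> ^ p)) \<le> liminf (\<lambda>m. ennreal (norm (?Q m \<omega>) ^ p))"
    proof eventually_elim
      case (elim \<omega>)
      show ?case
      proof (rule SUP_least)
        fix f assume "f \<in> D"
        then have "(\<lambda>m. ?P f m \<omega>) \<longlonglongrightarrow> ?S f \<omega>"
          using elim by (simp only: chaos_sum_def convergent_LIMSEQ_iff)
        then have "(\<lambda>m. ennreal (\<bar>?P f m \<omega>\<bar> ^ p)) \<longlonglongrightarrow> ennreal (\<bar>?S f \<omega>\<bar> ^ p)"
          by (intro tendsto_ennrealI tendsto_power tendsto_rabs)
        then have "ennreal (\<bar>?S f \<omega>\<bar> ^ p) = liminf (\<lambda>m. ennreal (\<bar>?P f m \<omega>\<bar> ^ p))"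
          by (rule lim_imp_Liminf[OF trivial_limit_sequentially, symmetric])
        also have "\<dots> \<le> liminf (\<lambda>m. ennreal (norm (?Q m \<omega>) ^ p))"
          unfolding blinfun_chaos_poly[symmetric] using norming_set_abs_le[OF assms(2) \<open>f \<in> D\<close>]
          by (intro Liminf_mono always_eventually allI ennreal_leI power_mono) auto
        finally show "ennreal (\<bar>?S f \<omega>\<bar> ^ p) \<le> liminf (\<lambda>m. ennreal (norm (?Q m \<omega>) ^ p))" .
      qed
    qed
  qed
  also have "\<dots> \<le> liminf (\<lambda>m. \<integral>\<^sup>+ \<omega>. ennreal (norm (?Q m \<omega>) ^ p) \<partial>N)"
    using norm_meas by (intro nn_integral_liminf measurable_compose[OF _ measurable_ennreal] borel_measurable_power)
  also have "(\<lambda>m. \<integral>\<^sup>+ \<omega>. ennreal (norm (?Q m \<omega>) ^ p) \<partial>N) = (\<lambda>m. ennreal (chaos_moment d x p m))"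
    unfolding chaos_moment_def
    by (intro ext nn_integral_rademacher[OF rad]) (auto intro!: arg_cong[where f = "\<lambda>y. norm y ^ p"] chaos_poly_cong)
  also have "liminf \<dots> \<le> liminf (\<lambda>_. ennreal B)"
    using bound by (intro Liminf_mono) (auto simp: eventually_sequentially intro!: exI[of _ n] ennreal_leI)
  also have "\<dots> = ennreal B" by (simp add: Liminf_const)
  finally show ?thesis .
qed

text \<open>With \<open>k = \<lfloor>x / L\<rfloor>\<close>, the single term \<open>(e x / (L k)) ^ (L k)\<close> is at least \<open>e ^ (L k)\<close>.\<close>

lemma exp_le_power_series:
  fixes x :: real
  assumes "0 \<le> x" "1 \<le> L"
  shows "ennreal (exp x) \<le> ennreal (exp (real L))
    * (1 + (\<Sum>k. ennreal ((exp 1 * x / (real L * real (Suc k))) ^ (L * Suc k))))"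
proof -
  define c where "c k = (exp 1 * x / (real L * real (Suc k))) ^ (L * Suc k)" for k
  have c_nonneg: "0 \<le> c k" for k using assms by (auto simp: c_def)
  define j where "j = nat \<lfloor>x / real L\<rfloor>"
  have "real j \<le> x / real L" "x / real L < real j + 1"
    using assms by (auto simp: j_def)
  then have j: "real L * real j \<le> x" "x \<le> real L + real L * real j"
    using assms by (auto simp: field_simps)
  have "ennreal (exp x) \<le> ennreal (exp (real L)) * ennreal (exp (real L * real j))"
    using j(2) by (simp add: ennreal_mult[symmetric] exp_add[symmetric])
  also have "ennreal (exp (real L * real j)) \<le> 1 + (\<Sum>k. ennreal (c k))"
  proof (cases j)
    \<comment> \<open>For \<open>x < L\<close> no term of the series is large; the constant summand
      1 takes over.\<close>
    case 0
    then show ?thesis by (simp add: ennreal_1[symmetric] del: ennreal_1)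
  next
    case (Suc k)
    have "exp (real L * real j) = exp 1 ^ (L * Suc k)"
      by (simp add: Suc exp_of_nat_mult[symmetric] algebra_simps)
    also have "\<dots> \<le> c k"
      unfolding c_def using j(1) assms Suc
      by (intro power_mono) (auto simp: le_divide_eq)
    finally have "ennreal (exp (real L * real j)) \<le> (\<Sum>i\<in>{k}. ennreal (c i))"
      by (simp add: ennreal_leI)
    also have "\<dots> \<le> (\<Sum>k. ennreal (c k))" by (intro sum_le_suminf) auto
    also have "\<dots> \<le> 1 + (\<Sum>k. ennreal (c k))" by simp
    finally show ?thesis .
  qed
  finally show ?thesis by (simp add: c_def mult_left_mono)
qed

text \<open>With \<open>L = d * r\<close>, the powers of \<open>z powr (2 / d)\<close> become the
  integer powers \<open>z ^ (2 * r * Suc k)\<close>, whose moments are under control.\<close>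

lemma exp_powr_moment_series:
  fixes z \<alpha> :: real
  assumes "0 \<le> z" "0 \<le> \<alpha>" "1 \<le> d" "1 \<le> r"
  shows "ennreal (exp (\<alpha> * z powr (2 / real d))) \<le> ennreal (exp (real (d * r)))
    * (1 + (\<Sum>k. ennreal ((exp 1 * \<alpha> / (real (d * r) * real (Suc k))) ^ (d * r * Suc k)) * ennreal (z ^ (2 * r * Suc k))))"
proof -
  have "(z powr (2 / real d)) ^ d = z\<^sup>2"
  proof (cases "z = 0")
    case True
    then show ?thesis using assms(3) by simp
  next
    case False
    then have "(z powr (2 / real d)) ^ d = z powr (real d * (2 / real d))"
      using assms(1) by (simp add: powr_power)
    then show ?thesis using assms(1,3) False by simp
  qed
  then have pow: "(z powr (2 / real d)) ^ (d * r * Suc k) = z ^ (2 * r * Suc k)" for k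
    by (simp only: power_mult)
  have "ennreal ((exp 1 * (\<alpha> * z powr (2 / real d)) / (real (d * r) * real (Suc k))) ^ (d * r * Suc k))
      = ennreal ((exp 1 * \<alpha> / (real (d * r) * real (Suc k))) ^ (d * r * Suc k)) * ennreal (z ^ (2 * r * Suc k))" for k
  proof -
    have "exp 1 * (\<alpha> * z powr (2 / real d)) / (real (d * r) * real (Suc k))
      = exp 1 * \<alpha> / (real (d * r) * real (Suc k)) * z powr (2 / real d)" by simp
    then show ?thesis
      using assms by (simp only: power_mult_distrib pow) (auto intro!: ennreal_mult)
  qed
  then show ?thesis
    using exp_le_power_series[of "\<alpha> * z powr (2 / real d)" "d * r"] assms by simp
qed

text \<open>Only the first summand of the moment bound survives in the limit of large \<open>k\<close>, and it is
  small because \<open>r\<close> is large.\<close>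

lemma moment_series_summable:
  fixes V C \<alpha> :: real
  assumes "0 < V" "1 \<le> C" "0 < \<alpha>" "1 \<le> d" "1 \<le> r"
    and r: "sqrt (2 * exp 1 * \<alpha> / real (d * r)) * (4 * C) \<le> 1"
  shows "summable (\<lambda>k. (exp 1 * \<alpha> / (real (d * r) * real (Suc k))) ^ (d * r * Suc k)
    * (sqrt (real (2 * Suc k)) ^ d * C + real n * (sqrt (real (2 * r * Suc k)) ^ (d - 1) * V)) ^ (2 * r * Suc k))"
proof -
  \<comment> \<open>With this root the summand is the \<open>(2 * r * Suc k)\<close>-th power of
    \<open>g k ^ d * b k\<close>, so it suffices to bring that base below 1/2 eventually.\<close>
  define g where "g k = sqrt (exp 1 * \<alpha> / (real (d * r) * real (Suc k)))" for k
  define b where "b k = sqrt (real (2 * Suc k)) ^ d * C + real n * (sqrt (real (2 * r * Suc k)) ^ (d - 1) * V)" for k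
  define A where "A = real n * (sqrt (2 * exp 1 * \<alpha> / real d) ^ (d - 1) * V)"
  have g_nonneg: "0 \<le> g k" for k using assms by (simp add: g_def)
  have b_nonneg: "0 \<le> b k" for k using assms by (simp add: b_def)
  \<comment> \<open>In the first summand of \<open>b k\<close> the growth cancels against
    \<open>g k ^ d\<close> and leaves \<open>s ^ d * C\<close>. The second has only
    \<open>d - 1\<close> growing factors, so one \<open>g k\<close>, which tends to zero, is left
    over.\<close>
  have gb: "g k ^ d * b k \<le> 1 / 4 + g k * A" for k
  proof -
    define s where "s = sqrt (2 * exp 1 * \<alpha> / real (d * r))"
    have s: "0 \<le> s" "s \<le> 1 / (4 * C)" using assms by (auto simp: s_def field_simps)
    have "s \<le> 1" using s assms(2) by (smt (verit) divide_le_eq_1)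
    have 1: "g k * sqrt (real (2 * Suc k)) = s"
      using assms unfolding g_def s_def real_sqrt_mult[symmetric] of_nat_mult of_nat_numeral
      by (intro arg_cong[where f = sqrt]) (simp add: field_simps del: of_nat_Suc)
    have 2: "g k * sqrt (real (2 * r * Suc k)) = sqrt (2 * exp 1 * \<alpha> / real d)"
      using assms unfolding g_def real_sqrt_mult[symmetric] of_nat_mult of_nat_numeral
      by (intro arg_cong[where f = sqrt]) (simp add: field_simps del: of_nat_Suc)
    have d: "d = Suc (d - 1)" using assms by simp
    have "g k ^ d * b k = (g k * sqrt (real (2 * Suc k))) ^ d * C
        + g k * (real n * ((g k * sqrt (real (2 * r * Suc k))) ^ (d - 1) * V))"
      unfolding b_def power_mult_distrib by (subst (1 2) d) (simp add: algebra_simps del: of_nat_Suc)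
    also have "\<dots> = s ^ d * C + g k * A" unfolding 1 2 A_def ..
    also have "s ^ d * C \<le> s * C"
      using s \<open>s \<le> 1\<close> assms power_decreasing[of 1 d s] by (intro mult_right_mono) auto
    also have "s * C \<le> 1 / 4" using s assms by (simp add: field_simps)
    finally show ?thesis by simp
  qed
  have "g \<longlonglongrightarrow> 0"
  proof -
    have "g = (\<lambda>k. sqrt (exp 1 * \<alpha> / real (d * r)) * sqrt (inverse (real (Suc k))))"
      unfolding g_def real_sqrt_mult[symmetric] by (simp add: field_simps)
    moreover have "(\<lambda>k. sqrt (exp 1 * \<alpha> / real (d * r)) * sqrt (inverse (real (Suc k)))) \<longlonglongrightarrow> sqrt (exp 1 * \<alpha> / real (d * r)) * sqrt 0"
      by (intro tendsto_mult tendsto_const tendsto_real_sqrt LIMSEQ_inverse_real_of_nat)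
    ultimately show ?thesis by simp
  qed
  then have "(\<lambda>k. g k * A) \<longlonglongrightarrow> 0" by (intro tendsto_mult_left_zero)
  then have ev: "\<forall>\<^sub>F k in sequentially. g k * A < 1 / 4" by (rule order_tendstoD) simp
  have eq: "(exp 1 * \<alpha> / (real (d * r) * real (Suc k))) ^ (d * r * Suc k) * b k ^ (2 * r * Suc k)
      = (g k ^ d * b k) ^ (2 * r * Suc k)" for k
  proof -
    have "exp 1 * \<alpha> / (real (d * r) * real (Suc k)) = (g k)\<^sup>2" using assms by (simp add: g_def)
    then show ?thesis
      by (simp only: power_mult_distrib power_mult[symmetric]) (simp only: mult.assoc mult.commute mult.left_commute)
  qed
  show ?thesis
    unfolding b_def[symmetric] eq
  proof (rule summable_comparison_test_ev)
    show "\<forall>\<^sub>F k in sequentially. norm ((g k ^ d * b k) ^ (2 * r * Suc k)) \<le> (1 / 2) ^ k"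
      using ev
    proof eventually_elim
      case (elim k)
      have "0 \<le> g k ^ d * b k" "g k ^ d * b k \<le> 1 / 2"
        using g_nonneg b_nonneg gb[of k] elim by auto
      then have "(g k ^ d * b k) ^ (2 * r * Suc k) \<le> (1 / 2) ^ (2 * r * Suc k)"
        by (intro power_mono)
      also have "k \<le> 1 * Suc k" by simp
      then have "k \<le> 2 * r * Suc k" using assms(5) mult_le_mono1[of 1 "2 * r" "Suc k"] by linarith
      then have "(1 / 2 :: real) ^ (2 * r * Suc k) \<le> (1 / 2) ^ k" by (intro power_decreasing) auto
      finally show ?case using \<open>0 \<le> g k ^ d * b k\<close> by simp
    qed
    show "summable (\<lambda>k. (1 / 2 :: real) ^ k)" by (rule summable_geometric) simp
  qed
qed

theorem theorem7:
  fixes d :: nat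
    and D :: "('b::banach \<Rightarrow>\<^sub>L real) set"
    and N :: "'c measure" and \<epsilon> :: "nat \<Rightarrow> 'c \<Rightarrow> real"
    and M :: "'a measure" and X :: "'a \<Rightarrow> 'b"
    and \<alpha> :: real
  assumes "d \<ge> 1"
    and "countable D" and "norming_set D"
    and "rademacher_sequence N \<epsilon>"
    and "prob_space M"
    and "homogeneous_rademacher_chaos d D N \<epsilon> M X"
  shows "(\<integral>\<^sup>+ \<omega>. ennreal (exp (\<alpha> * norm (X \<omega>) powr (2 / real d))) \<partial>M) < \<infinity>"
proof (cases "0 < \<alpha> \<and> D \<noteq> {}")
  case False
  \<comment> \<open>For \<open>D = {}\<close> the norm vanishes, and \<open>0 powr (2 / d)\<close>
    is 0.\<close>
  have "\<alpha> * norm (X \<omega>) powr (2 / real d) \<le> 0" for \<omega>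
    using False norming_set_empty_norm[OF assms(3), of "X \<omega>"] by (auto simp: mult_nonpos_nonneg)
  then have "(\<integral>\<^sup>+ \<omega>. ennreal (exp (\<alpha> * norm (X \<omega>) powr (2 / real d))) \<partial>M) \<le> (\<integral>\<^sup>+ \<omega>. 1 \<partial>M)"
    by (intro nn_integral_mono) simp
  also have "\<dots> < \<infinity>" using prob_space.emeasure_space_1[OF assms(5)] by simp
  finally show ?thesis .
next
  case True
  obtain x where X: "random_variable_via D M X" and x: "symmetric_tetrahedral d x"
    and conv: "\<And>f. f \<in> D \<Longrightarrow> AE \<omega> in N. convergent (\<lambda>n. chaos_partial_sum d (\<lambda>is. blinfun_apply f (x is)) \<epsilon> n \<omega>)"
    and law: "distr N (PiM D (\<lambda>_. borel)) (\<lambda>\<omega>. \<lambda>f\<in>D. chaos_sum d (\<lambda>is. blinfun_apply f (x is)) \<epsilon> \<omega>)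
      = distr M (PiM D (\<lambda>_. borel)) (\<lambda>\<omega>. \<lambda>f\<in>D. blinfun_apply f (X \<omega>))"
    using assms(6) unfolding homogeneous_rademacher_chaos_def by blast
  obtain V where V: "0 < V" "\<And>m. chaos_moment d x 2 m \<le> V\<^sup>2"
    using chaos_second_moment_bounded[OF assms(2-5) X x conv law] by blast
  define C where "C = 2 * (2 + V\<^sup>2)"
  have "1 \<le> C" by (simp add: C_def)
  \<comment> \<open>This makes the constant part of the root of the series at most 1/4. It is
    possible for every \<alpha> because \<open>C\<close> was fixed before \<open>r\<close>.\<close>
  obtain r :: nat where "max 1 (2 * exp 1 * \<alpha> * (4 * C)\<^sup>2) \<le> real r" using real_arch_simple by blast
  then have r: "1 \<le> r" "2 * exp 1 * \<alpha> * (4 * C)\<^sup>2 \<le> real r" by auto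
  have "2 * exp 1 * \<alpha> / real (d * r) * (4 * C)\<^sup>2 \<le> 1"
  proof -
    have "real r \<le> real (d * r)" using assms(1) mult_le_mono1[of 1 d r] by (simp only: of_nat_le_iff mult_1)
    then have "2 * exp 1 * \<alpha> * (4 * C)\<^sup>2 \<le> real (d * r)" using r(2) by linarith
    moreover have "0 < real (d * r)" using assms(1) r(1) by simp
    ultimately show ?thesis unfolding times_divide_eq_left by (simp only: divide_le_eq_1_pos)
  qed
  then have "sqrt (2 * exp 1 * \<alpha> / real (d * r) * (4 * C)\<^sup>2) \<le> 1"
    by (simp only: real_sqrt_le_1_iff)
  moreover have "\<bar>4 * C\<bar> = 4 * C" using \<open>1 \<le> C\<close> by simp
  ultimately have small: "sqrt (2 * exp 1 * \<alpha> / real (d * r)) * (4 * C) \<le> 1"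
    by (simp only: real_sqrt_mult real_sqrt_abs)
  obtain n where n: "\<And>m k. n \<le> m \<Longrightarrow> 1 \<le> k \<Longrightarrow> chaos_moment d x (2 * r * k) m
      \<le> (sqrt (real (2 * k)) ^ d * C + real n * (sqrt (real (2 * r * k)) ^ (d - 1) * V)) ^ (2 * r * k)"
    using chaos_moment_le[OF x assms(1) V r(1)] unfolding C_def by blast
  define B where "B k = (sqrt (real (2 * Suc k)) ^ d * C + real n * (sqrt (real (2 * r * Suc k)) ^ (d - 1) * V)) ^ (2 * r * Suc k)" for k
  define a where "a k = (exp 1 * \<alpha> / (real (d * r) * real (Suc k))) ^ (d * r * Suc k)" for k
  have nonneg: "0 \<le> a k" "0 \<le> B k" for k
    using True \<open>1 \<le> C\<close> V(1) by (auto simp: a_def B_def simp del: of_nat_Suc)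
  note norm_meas = borel_measurable_norm_via[OF assms(2,3) X]
  have meas: "(\<lambda>\<omega>. ennreal (norm (X \<omega>) ^ p)) \<in> borel_measurable M" for p
    using norm_meas by measurable
  have moment: "(\<integral>\<^sup>+ \<omega>. ennreal (norm (X \<omega>) ^ (2 * r * Suc k)) \<partial>M) \<le> ennreal (B k)" for k
  proof (rule chaos_moment_fatou[OF assms(2,3) _ assms(4) X conv law])
    show "chaos_moment d x (2 * r * Suc k) m \<le> B k" if "n \<le> m" for m
      unfolding B_def using n[OF that, of "Suc k"] by (simp only: le_add1 plus_1_eq_Suc)
  qed (use True r(1) in auto)
  have "(\<integral>\<^sup>+ \<omega>. ennreal (exp (\<alpha> * norm (X \<omega>) powr (2 / real d))) \<partial>M)
      \<le> (\<integral>\<^sup>+ \<omega>. ennreal (exp (real (d * r))) * (1 + (\<Sum>k. ennreal (a k) * ennreal (norm (X \<omega>) ^ (2 * r * Suc k)))) \<partial>M)"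
    unfolding a_def using True assms(1) r(1) by (intro nn_integral_mono exp_powr_moment_series) auto
  also have "\<dots> = ennreal (exp (real (d * r)))
      * (1 + (\<Sum>k. ennreal (a k) * (\<integral>\<^sup>+ \<omega>. ennreal (norm (X \<omega>) ^ (2 * r * Suc k)) \<partial>M)))"
    using meas prob_space.emeasure_space_1[OF assms(5)]
    by (simp add: nn_integral_cmult nn_integral_add nn_integral_suminf del: power_Suc mult_Suc_right)
  also have "\<dots> \<le> ennreal (exp (real (d * r))) * (1 + (\<Sum>k. ennreal (a k * B k)))"
    using moment nonneg by (intro mult_left_mono add_left_mono suminf_le) (auto simp: ennreal_mult intro!: mult_left_mono)
  also have "\<dots> < \<infinity>"
  proof -
    have "summable (\<lambda>k. a k * B k)"
      unfolding a_def B_def using True \<open>1 \<le> C\<close> V(1) assms(1) r(1) small by (intro moment_series_summable) auto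
    then have "(\<Sum>k. ennreal (a k * B k)) \<noteq> \<top>" using nonneg by (intro ennreal_suminf_neq_top) auto
    then show ?thesis by (simp add: ennreal_mult_less_top less_top)
  qed
  finally show ?thesis .
qed

end
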